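(* Let $1\le k\le N$ be integers and let $\epsilon>0$ satisfy $2.3766\cdot\epsilon N<1$. Then the price of anarchy of the $\epsilon$-discretized Bayesian persuasion game with $N$ agents and $k$ selection is at most $$\frac{22.459}{1-2.3766\cdot\epsilon N},$$ (which is close to $22.459$ when $\epsilon\ll 1/N$); that is, for every (possibly mixed) Nash equilibrium $\mathcal Z$, $\mathrm{SW}^{\max}\le \frac{22.459}{1-2.3766\,\epsilon N}\cdot\mathrm{SW}(\mathcal Z)$.
   Context: The $\epsilon$-discretized Bayesian persuasion game. There are $N$ agents and a principal who selects $k$ agents. Let $V=\{v_{(1)},\dots,v_{(M)}\}\subset[0,1]$ be a finite set of values. Agent $i$'s value $v_i$ is drawn from a prior $\mathcal F_i$ on $V$, independently across agents, and every probability $\Pr[v_i=v]$ equals $t_{iv}\epsilon$ for some integer $t_{iv}\ge0$. A (pure) strategy of agent $i$ is a signaling scheme $\mathcal Z_i=(\Sigma_i,\pi_i)$ such that for every $v\in V$ with $t_{iv}\ge1$ and every signal $\sigma_i\in\Sigma_i$, $\Pr[\sigma_i\text{ is sent}\mid v_i=v]=\pi_i(\sigma_i\mid v)$ is an integer multiple of $1/t_{iv}$ (so, up to relabeling signals, there are finitely many pure strategies). Given $v_i$, $\sigma_i$ is drawn from $\pi_i(\cdot\mid v_i)$, independently across agents. Let $e_i(\sigma_i)=\mathbb E[v_i\mid\sigma_i]$ be the posterior mean under the scheme used, and $e_{(1)}(\boldsymbol\sigma)\ge\cdots\ge e_{(N)}(\boldsymbol\sigma)$ the sorted posterior means. The principal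 selects the $k$ agents with the highest posterior means, breaking ties uniformly at random; $\rho_i(\boldsymbol\sigma)$ is the resulting selection probability of agent $i$. An agent selected with value $v$ gets utility $u_i(v)$ (otherwise $0$), where $u_i:[0,1]\to\mathbb R_{\ge0}$ is continuous, weakly increasing and $u_i(v)>0$ for $v>0$. For a pure profile, $u_i(\mathcal Z)=\mathbb E[\rho_i(\boldsymbol\sigma)\,\mathbb E[u_i(v_i)\mid\sigma_i]]$ and $\mathrm{SW}(\mathcal Z)=\mathbb E[\sum_{j=1}^k e_{(j)}(\boldsymbol\sigma)]$. Agents may mix over signaling schemes (independently); payoffs and social welfare of a mixed profile are the expectations over the realized pure profiles, and Nash equilibrium is in the usual sense for this finite game. $\mathrm{SW}^{\max}=\mathbb E[\max_{S\subseteq[N],|S|=k}\sum_{i\in S}v_i]$, and the price of anarchy is $\mathrm{SW}^{\max}/\inf\mathrm{SW}(\mathcal Z)$, the infimum over Nash equilibria. *)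

theory Defs
  imports "HOL-Probability.Probability"
begin

text \<open>
  Since every on-path signal has conditional probability at least \<open>1 / t i v\<close> for some
  value \<open>v\<close>, a discretized scheme only ever sends finitely many signals; natural numbers
  therefore provide enough labels for every scheme, up to relabeling.
\<close>

record scheme =
  signals :: "nat set"
  kernel :: "real \<Rightarrow> nat pmf"

locale persuasion_game =
  fixes N k :: nat
    and \<epsilon> :: real
    and V :: "real set"
    and t :: "nat \<Rightarrow> real \<Rightarrow> nat"
    and F :: "nat \<Rightarrow> real pmf"
    and u :: "nat \<Rightarrow> real \<Rightarrow> real"
  assumes k_ge_1: "1 \<le> k"
    and k_le_N: "k \<le> N"
    and eps_pos: "\<epsilon> > 0"
    and finite_V: "finite V"
    and V_unit: "V \<subseteq> {0..1}"
    and prior_support: "\<And>i. i < N \<Longrightarrow> set_pmf (F i) \<subseteq> V"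
    and prior_mass: "\<And>i v. i < N \<Longrightarrow> v \<in> V \<Longrightarrow> pmf (F i) v = real (t i v) * \<epsilon>"
    and u_cont: "\<And>i. i < N \<Longrightarrow> continuous_on {0..1} (u i)"
    and u_mono: "\<And>i. i < N \<Longrightarrow> mono_on {0..1} (u i)"
    and u_nonneg: "\<And>i v. i < N \<Longrightarrow> v \<in> {0..1} \<Longrightarrow> u i v \<ge> 0"
    and u_pos: "\<And>i v. i < N \<Longrightarrow> v \<in> {0<..1} \<Longrightarrow> u i v > 0"
begin

definition pure_strategies :: "nat \<Rightarrow> scheme set" where
  "pure_strategies i = {Z.
     (\<forall>v\<in>V. set_pmf (kernel Z v) \<subseteq> signals Z) \<and>
     (\<forall>v\<in>V. t i v \<ge> 1 \<longrightarrow>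
       (\<forall>s\<in>signals Z. \<exists>m::int. pmf (kernel Z v) s = of_int m * (1 / real (t i v))))}"

definition value_signal :: "nat \<Rightarrow> scheme \<Rightarrow> (real \<times> nat) pmf" where
  "value_signal i Z = do { v \<leftarrow> F i; s \<leftarrow> kernel Z v; return_pmf (v, s) }"

text \<open>
  The conditional law is meaningful only for signals of positive probability; it is never
  evaluated at other signals except with weight zero.
\<close>

definition posterior :: "nat \<Rightarrow> scheme \<Rightarrow> nat \<Rightarrow> real pmf" where
  "posterior i Z s = map_pmf fst (cond_pmf (value_signal i Z) {x. snd x = s})"

definition posterior_mean :: "nat \<Rightarrow> scheme \<Rightarrow> nat \<Rightarrow> real" where
  "posterior_mean i Z s = measure_pmf.expectation (posterior i Z s) (\<lambda>v. v)"

definition posterior_utility :: "nat \<Rightarrow> scheme \<Rightarrow> nat \<Rightarrow> real" where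
  "posterior_utility i Z s = measure_pmf.expectation (posterior i Z s) (u i)"

definition signal_profile :: "(nat \<Rightarrow> scheme) \<Rightarrow> (nat \<Rightarrow> nat) pmf" where
  "signal_profile Z = Pi_pmf {..<N} 0 (\<lambda>i. map_pmf snd (value_signal i (Z i)))"

definition k_subsets :: "nat set set" where
  "k_subsets = {S. S \<subseteq> {..<N} \<and> card S = k}"

definition top_sets :: "(nat \<Rightarrow> real) \<Rightarrow> nat set set" where
  "top_sets e = {S \<in> k_subsets. \<forall>i\<in>S. \<forall>j\<in>{..<N} - S. e j \<le> e i}"

text \<open>
  Two sets of top \<open>k\<close> agents differ only in which of the agents tied at the threshold
  they contain, so uniform tie-breaking is the uniform choice of such a set.
\<close>

definition selection_prob :: "(nat \<Rightarrow> real) \<Rightarrow> nat \<Rightarrow> real" where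
  "selection_prob e i = measure_pmf.prob (pmf_of_set (top_sets e)) {S. i \<in> S}"

definition posterior_means :: "(nat \<Rightarrow> scheme) \<Rightarrow> (nat \<Rightarrow> nat) \<Rightarrow> nat \<Rightarrow> real" where
  "posterior_means Z \<sigma> = (\<lambda>i. posterior_mean i (Z i) (\<sigma> i))"

definition pure_payoff :: "nat \<Rightarrow> (nat \<Rightarrow> scheme) \<Rightarrow> real" where
  "pure_payoff i Z = measure_pmf.expectation (signal_profile Z)
     (\<lambda>\<sigma>. selection_prob (posterior_means Z \<sigma>) i * posterior_utility i (Z i) (\<sigma> i))"

text \<open>Zero-based: \<open>order_stat e j\<close> is the \<open>(j+1)\<close>-st largest of \<open>e 0, \<dots>, e (N - 1)\<close>.\<close>

definition order_stat :: "(nat \<Rightarrow> real) \<Rightarrow> nat \<Rightarrow> real" where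
  "order_stat e j = rev (sort (map e [0..<N])) ! j"

definition pure_SW :: "(nat \<Rightarrow> scheme) \<Rightarrow> real" where
  "pure_SW Z = measure_pmf.expectation (signal_profile Z)
     (\<lambda>\<sigma>. \<Sum>j<k. order_stat (posterior_means Z \<sigma>) j)"

definition mixed_profile :: "(nat \<Rightarrow> scheme pmf) \<Rightarrow> bool" where
  "mixed_profile M \<longleftrightarrow> (\<forall>i<N. set_pmf (M i) \<subseteq> pure_strategies i)"

definition realized_profile :: "(nat \<Rightarrow> scheme pmf) \<Rightarrow> (nat \<Rightarrow> scheme) pmf" where
  "realized_profile M = Pi_pmf {..<N} undefined M"

definition payoff :: "nat \<Rightarrow> (nat \<Rightarrow> scheme pmf) \<Rightarrow> real" where
  "payoff i M = measure_pmf.expectation (realized_profile M) (pure_payoff i)"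

definition SW :: "(nat \<Rightarrow> scheme pmf) \<Rightarrow> real" where
  "SW M = measure_pmf.expectation (realized_profile M) pure_SW"

definition nash_equilibrium :: "(nat \<Rightarrow> scheme pmf) \<Rightarrow> bool" where
  "nash_equilibrium M \<longleftrightarrow> mixed_profile M \<and>
     (\<forall>i<N. \<forall>\<tau>. set_pmf \<tau> \<subseteq> pure_strategies i \<longrightarrow> payoff i (M(i := \<tau>)) \<le> payoff i M)"

definition SW_max :: real where
  "SW_max = measure_pmf.expectation (Pi_pmf {..<N} 0 F) (\<lambda>v. MAX S\<in>k_subsets. \<Sum>i\<in>S. v i)"

text \<open>
  Extended reals make the degenerate ratios explicit: \<open>x / 0 = \<infinity>\<close> for \<open>x > 0\<close>, and
  \<open>0 / 0 = 0\<close>.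
\<close>

definition price_of_anarchy :: ereal where
  "price_of_anarchy = ereal SW_max / (INF M\<in>{M. nash_equilibrium M}. ereal (SW M))"

end

end

theory Submission imports Defs begin

text \<open>
  Let \<open>\<theta> = 3 SW / k\<close>. By Markov's inequality the \<open>k\<close>-th largest posterior mean stays below
  \<open>\<theta>\<close> with probability at least \<open>2 / 3\<close>, so an agent who sends a signal of posterior mean at least
  \<open>\<theta>\<close> is selected with at least that probability. Call a signal used in equilibrium bad if it wins
  with probability below \<open>1 / 3\<close>; its posterior mean is then below \<open>\<theta>\<close>. A value above \<open>\<theta>\<close> sent
  with a signal that is not bad contributes at least a third of its mass to the welfare. On the bad
  signals the agent could pool the highest values with just enough lower ones to reach mean
  \<open>\<theta>\<close>. Since this does not pay and \<open>u i\<close> is increasing, the pooled mass is at most three times the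
  probability of being selected with a bad signal, and these probabilities sum to at most \<open>k\<close> over
  the agents. Rounding the pool to whole units of mass \<open>\<epsilon>\<close> costs at most \<open>\<epsilon> \<theta>\<close> per agent. As
  \<open>SW_max \<le> k \<theta> + (\<Sum>i<N. E (v i - \<theta>)\<^sup>+)\<close>, altogether \<open>SW_max \<le> (15 + 3 \<epsilon> N) SW\<close>, and
  \<open>15 + 3 x \<le> 22.459 / (1 - 2.3766 x)\<close> for \<open>0 \<le> x < 1 / 2.3766\<close>.
\<close>

section \<open>Expectations over probability mass functions\<close>

text \<open>\<open>integral_bind\<close> asks for a bound on the integrand at every point. Setting
  \<open>g\<close> to zero off the support supplies one and changes neither side.\<close>

lemma expectation_bind_pmf:
  fixes g :: "'b \<Rightarrow> real"
  assumes "\<And>y. y \<in> set_pmf (bind_pmf p f) \<Longrightarrow> \<bar>g y\<bar> \<le> B"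
  shows "measure_pmf.expectation (bind_pmf p f) g
       = measure_pmf.expectation p (\<lambda>x. measure_pmf.expectation (f x) g)"
proof -
  define g' where "g' y = (if y \<in> set_pmf (bind_pmf p f) then g y else 0)" for y
  have B: "\<bar>g' y\<bar> \<le> \<bar>B\<bar>" for y
    using assms[of y] by (cases "y \<in> set_pmf (bind_pmf p f)") (auto simp: g'_def simp del: set_bind_pmf)
  have "measure_pmf.expectation (bind_pmf p f) g = measure_pmf.expectation (bind_pmf p f) g'"
    by (intro integral_cong_AE) (auto simp: AE_measure_pmf_iff g'_def)
  also have "\<dots> = measure_pmf.expectation p (\<lambda>x. measure_pmf.expectation (f x) g')"
    unfolding measure_pmf_bind
    by (rule integral_bind[where B = "\<bar>B\<bar>" and K = "count_space UNIV" and B' = 1])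
       (use B in \<open>auto simp: measure_pmf_in_subprob_algebra\<close>)
  also have "\<dots> = measure_pmf.expectation p (\<lambda>x. measure_pmf.expectation (f x) g)"
    by (intro integral_cong_AE) (auto simp: AE_measure_pmf_iff g'_def intro!: integral_cong_AE)
  finally show ?thesis .
qed

lemma expectation_cong_pmf:
  fixes g :: "'a \<Rightarrow> real"
  assumes "\<And>x. x \<in> set_pmf p \<Longrightarrow> f x = g x"
  shows "measure_pmf.expectation p f = measure_pmf.expectation p g"
  using assms by (intro integral_cong_AE) (auto simp: AE_measure_pmf_iff)

lemma integrable_pmf_bounded:
  fixes f :: "'a \<Rightarrow> real"
  assumes "\<And>x. x \<in> set_pmf p \<Longrightarrow> \<bar>f x\<bar> \<le> B"
  shows "integrable (measure_pmf p) f"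
  using assms
  by (intro measure_pmf.integrable_const_bound[where B = B]) (auto simp: AE_measure_pmf_iff)

lemma expectation_mono_pmf:
  fixes f g :: "'a \<Rightarrow> real"
  assumes "\<And>x. x \<in> set_pmf p \<Longrightarrow> \<bar>f x\<bar> \<le> A" "\<And>x. x \<in> set_pmf p \<Longrightarrow> \<bar>g x\<bar> \<le> B"
    and "\<And>x. x \<in> set_pmf p \<Longrightarrow> f x \<le> g x"
  shows "measure_pmf.expectation p f \<le> measure_pmf.expectation p g"
  using assms
  by (intro integral_mono_AE integrable_pmf_bounded[of p f A] integrable_pmf_bounded[of p g B])
     (auto simp: AE_measure_pmf_iff)

lemma expectation_bounds_pmf:
  fixes f :: "'a \<Rightarrow> real"
  assumes "\<And>x. x \<in> set_pmf p \<Longrightarrow> a \<le> f x" "\<And>x. x \<in> set_pmf p \<Longrightarrow> f x \<le> b"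
  shows "a \<le> measure_pmf.expectation p f" "measure_pmf.expectation p f \<le> b"
proof -
  have i: "integrable (measure_pmf p) f"
    by (rule integrable_pmf_bounded[where B = "\<bar>a\<bar> + \<bar>b\<bar>"]) (use assms in fastforce)
  show "a \<le> measure_pmf.expectation p f"
    using i assms by (intro measure_pmf.integral_ge_const) (auto simp: AE_measure_pmf_iff)
  show "measure_pmf.expectation p f \<le> b"
    using i assms by (intro measure_pmf.integral_le_const) (auto simp: AE_measure_pmf_iff)
qed

text \<open>At most \<open>1 / c\<close> atoms of mass \<open>c\<close> or more fit into total mass
  one.\<close>

lemma finite_set_pmf_ge:
  assumes "0 < c" "\<And>x. x \<in> set_pmf p \<Longrightarrow> c \<le> pmf p x"
  shows "finite (set_pmf p)"
proof (rule finite_if_finite_subsets_card_bdd[THEN conjunct1])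
  fix A assume A: "A \<subseteq> set_pmf p" "finite A"
  have "real (card A) * c \<le> (\<Sum>x\<in>A. pmf p x)"
    using A assms by (intro sum_bounded_below) auto
  also have "\<dots> = measure_pmf.prob p A" using A by (simp add: measure_measure_pmf_finite)
  also have "\<dots> \<le> 1" by simp
  finally show "card A \<le> nat \<lfloor>1 / c\<rfloor>"
    using assms(1) by (simp add: le_nat_floor pos_le_divide_eq)
qed

section \<open>Greedy pooling\<close>

text \<open>Masses are counted in units of \<open>\<epsilon>\<close>; the unit that no longer fits into the pool costs at
  most \<open>\<theta>\<close>.\<close>

lemma greedy_pool_exists:
  fixes b :: "real \<Rightarrow> nat" and \<theta> :: real
  assumes V: "finite V" "V \<noteq> {}" "V \<subseteq> {0..}" and \<theta>: "0 < \<theta>"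
    and low_mean: "(\<Sum>v\<in>V. real (b v) * (v - \<theta>)) \<le> 0"
  obtains v0 :: real and c :: "real \<Rightarrow> nat" where "v0 \<in> V"
    "\<forall>v\<in>V. c v \<le> b v \<and> (v0 < v \<longrightarrow> c v = b v) \<and> (v < v0 \<longrightarrow> c v = 0)"
    "0 \<le> (\<Sum>v\<in>V. real (c v) * (v - \<theta>))"
    "(\<Sum>v\<in>V. real (b v) * max 0 (v - \<theta>)) \<le> \<theta> * ((\<Sum>v\<in>V. real (c v)) + 1)"
proof -
  \<comment> \<open>\<open>A w\<close> is the surplus over \<theta> when all mass at values \<ge>
    \<open>w\<close> is pooled; \<open>W\<close> collects the cut-offs at which the pool would have
    mean below \<theta>.\<close>
  define A where "A w = (\<Sum>v\<in>{v\<in>V. w \<le> v}. real (b v) * (v - \<theta>))" for w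
  define W where "W = {w\<in>V. A w < 0}"
  have finW: "finite W" using V by (simp add: W_def)
  show thesis
  proof (cases "W = {}")
    case True
    then have "0 \<le> A (Min V)" using V by (auto simp: W_def not_less)
    moreover have "{v\<in>V. Min V \<le> v} = V" using V by auto
    ultimately have ge: "0 \<le> (\<Sum>v\<in>V. real (b v) * (v - \<theta>))" by (simp add: A_def)
    have "(\<Sum>v\<in>V. real (b v) * max 0 (v - \<theta>)) \<le> (\<Sum>v\<in>V. real (b v) * v)"
      using V \<theta> by (intro sum_mono mult_left_mono) auto
    also have "\<dots> = (\<Sum>v\<in>V. real (b v) * (v - \<theta>)) + \<theta> * (\<Sum>v\<in>V. real (b v))"
      by (simp add: sum_distrib_left sum.distrib[symmetric] algebra_simps)
    also have "\<dots> \<le> \<theta> * ((\<Sum>v\<in>V. real (b v)) + 1)"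
      using low_mean \<theta> by (simp add: distrib_left)
    finally show thesis
      using V ge by (intro that[of "Min V" b]) auto
  next
    case False
    \<comment> \<open>Scanning from the top, \<open>v0\<close> is the first value that no longer
      fits entirely. The values \<open>U\<close> above it fit, with surplus
      \<open>S\<close>.\<close>
    define v0 where "v0 = Max W"
    have v0: "v0 \<in> W" "\<And>w. w \<in> W \<Longrightarrow> w \<le> v0" using False finW by (auto simp: v0_def)
    define U where "U = {v\<in>V. v0 < v}"
    define S where "S = (\<Sum>v\<in>U. real (b v) * (v - \<theta>))"
    have finU: "finite U" and UV: "U \<subseteq> V" using V by (auto simp: U_def)
    have S0: "0 \<le> S"
    proof (cases "U = {}")
      case False
      have "Min U \<in> U" using False finU by simp
      then have "Min U \<notin> W" using v0(2)[of "Min U"] by (auto simp: U_def)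
      then have "0 \<le> A (Min U)" using \<open>Min U \<in> U\<close> by (auto simp: W_def U_def not_less)
      moreover have "v \<in> V \<and> Min U \<le> v \<longleftrightarrow> v \<in> U" for v
        using \<open>Min U \<in> U\<close> Min_le[OF finU, of v] unfolding U_def mem_Collect_eq
        by (auto simp only: mem_Collect_eq)
      then have "{v\<in>V. Min U \<le> v} = U" by blast
      ultimately show ?thesis by (simp add: A_def S_def)
    qed (simp add: S_def)
    have v0V: "v0 \<in> V" and "A v0 < 0" using v0 by (auto simp: W_def)
    moreover have "{v\<in>V. v0 \<le> v} = insert v0 U" using v0V by (auto simp: U_def)
    ultimately have neg: "real (b v0) * (v0 - \<theta>) + S < 0"
      using finU by (simp add: A_def S_def U_def)
    then have v0_lt: "v0 < \<theta>"
      using S0 by (smt (verit) mult_nonneg_nonneg of_nat_0_le_iff)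
    \<comment> \<open>Each unit of value \<open>v0\<close> costs \<open>\<theta> - v0\<close>, so
      the surplus \<open>S\<close> pays for this many whole units.\<close>
    define c0 where "c0 = nat \<lfloor>S / (\<theta> - v0)\<rfloor>"
    have q0: "0 \<le> S / (\<theta> - v0)" using S0 v0_lt by simp
    have "real c0 \<le> S / (\<theta> - v0)" using q0 by (simp add: c0_def)
    then have c0_le: "real c0 * (\<theta> - v0) \<le> S" using v0_lt by (simp add: pos_le_divide_eq)
    have "S / (\<theta> - v0) < real c0 + 1" using q0 unfolding c0_def by linarith
    then have c0_gt: "S < (real c0 + 1) * (\<theta> - v0)" using v0_lt by (simp add: pos_divide_less_eq)
    have "real c0 * (\<theta> - v0) < real (b v0) * (\<theta> - v0)"
      using c0_le neg by (simp add: algebra_simps)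
    then have c0_b: "c0 < b v0" using v0_lt by simp
    define c where "c v = (if v0 < v then b v else if v = v0 then c0 else 0)" for v
    have split: "(\<Sum>v\<in>V. real (c v) * f v) = real c0 * f v0 + (\<Sum>v\<in>U. real (b v) * f v)" for f
    proof -
      have "(\<Sum>v\<in>V. real (c v) * f v) = (\<Sum>v\<in>insert v0 U. real (c v) * f v)"
        using V v0V by (intro sum.mono_neutral_right) (auto simp: c_def U_def)
      also have "\<dots> = real (c v0) * f v0 + (\<Sum>v\<in>U. real (c v) * f v)"
        using finU by (simp add: U_def)
      also have "(\<Sum>v\<in>U. real (c v) * f v) = (\<Sum>v\<in>U. real (b v) * f v)"
        by (intro sum.cong) (auto simp: c_def U_def)
      finally show ?thesis by (simp add: c_def)
    qed
    have mean: "0 \<le> (\<Sum>v\<in>V. real (c v) * (v - \<theta>))"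
      unfolding split using c0_le S_def by (simp add: algebra_simps)
    have "(\<Sum>v\<in>V. real (b v) * max 0 (v - \<theta>)) = (\<Sum>v\<in>U. real (b v) * max 0 (v - \<theta>))"
      using V v0_lt by (intro sum.mono_neutral_right) (auto simp: U_def)
    also have "\<dots> \<le> (\<Sum>v\<in>U. real (b v) * (v - \<theta>) + real (b v) * \<theta>)"
      using V \<theta> by (intro sum_mono) (auto simp: algebra_simps U_def max_def)
    also have "\<dots> = S + \<theta> * (\<Sum>v\<in>U. real (b v))"
      by (simp add: sum.distrib S_def sum_distrib_left mult.commute)
    \<comment> \<open>One more unit at \<open>v0\<close> would overdraw the surplus, and
      \<open>v0\<close> is nonnegative. This unit is the \<open>+ 1\<close> of the bound.\<close>
    also have "S \<le> (real c0 + 1) * \<theta>"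
    proof -
      have "(real c0 + 1) * (\<theta> - v0) \<le> (real c0 + 1) * \<theta>"
        using V v0V by (intro mult_left_mono) auto
      then show ?thesis using c0_gt by linarith
    qed
    also have "(real c0 + 1) * \<theta> + \<theta> * (\<Sum>v\<in>U. real (b v)) = \<theta> * ((\<Sum>v\<in>V. real (c v)) + 1)"
      using split[of "\<lambda>_. 1"] by (simp add: algebra_simps)
    finally have "(\<Sum>v\<in>V. real (b v) * max 0 (v - \<theta>)) \<le> \<theta> * ((\<Sum>v\<in>V. real (c v)) + 1)" by simp
    then show thesis
      using v0V mean c0_b by (intro that[of v0 c]) (auto simp: c_def)
  qed
qed

text \<open>Here \<open>H v\<close> stands for the mass at \<open>v\<close> selected with a bad
  signal, and \<open>2 / 3\<close> for the winning probability of the pool. If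
  \<open>u v0 > 0\<close>, every summand of \<open>gain\<close> is at most
  \<open>u v0 * (H v - c v / 3)\<close>: below \<open>v0\<close> nothing is pooled and the utility
  is smaller; above \<open>v0\<close> all bad mass is pooled, so the bracket is negative and a
  smaller factor only raises it. Dividing by \<open>u v0\<close> gives the claim.\<close>

lemma pooled_mass_bound:
  fixes b c H :: "real \<Rightarrow> real" and u :: "real \<Rightarrow> real"
  assumes V: "finite V" "V \<subseteq> {0..}" and v0: "v0 \<in> V" and \<theta>: "0 < \<theta>"
    and u: "\<And>v w. v \<in> V \<Longrightarrow> w \<in> V \<Longrightarrow> v \<le> w \<Longrightarrow> u v \<le> u w"
      "\<And>v. v \<in> V \<Longrightarrow> 0 \<le> u v" "\<And>v. v \<in> V \<Longrightarrow> 0 < v \<Longrightarrow> 0 < u v"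
    and c: "\<And>v. v \<in> V \<Longrightarrow> 0 \<le> c v" "\<And>v. v \<in> V \<Longrightarrow> c v \<le> b v"
      "\<And>v. v \<in> V \<Longrightarrow> v0 < v \<Longrightarrow> c v = b v" "\<And>v. v \<in> V \<Longrightarrow> v < v0 \<Longrightarrow> c v = 0"
    and mean: "0 \<le> (\<Sum>v\<in>V. c v * (v - \<theta>))"
    and H: "\<And>v. v \<in> V \<Longrightarrow> 0 \<le> H v" "\<And>v. v \<in> V \<Longrightarrow> H v \<le> b v / 3"
    and gain: "0 \<le> (\<Sum>v\<in>V. u v * (H v - 2 / 3 * c v))"
  shows "(\<Sum>v\<in>V. c v) \<le> 3 * (\<Sum>v\<in>V. H v)"
proof (cases "u v0 = 0")
  case False
  then have u0: "0 < u v0" using u(2)[OF v0] by simp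
  have "u v * (H v - 2 / 3 * c v) \<le> u v0 * (H v - c v / 3)" if v: "v \<in> V" for v
  proof -
    consider "v < v0" | "v = v0" | "v0 < v" by linarith
    then show ?thesis
    proof cases
      case 1
      then have "u v * H v \<le> u v0 * H v" using u(1)[OF v v0] H(1)[OF v] by (intro mult_right_mono) auto
      then show ?thesis using c(4)[OF v 1] by simp
    next
      case 2
      then show ?thesis using c(1)[OF v] u0 by (auto intro!: mult_left_mono)
    next
      case 3
      have "H v - 2 / 3 * c v \<le> - (c v / 3)" using H(2)[OF v] c(3)[OF v 3] by simp
      then have "u v * (H v - 2 / 3 * c v) \<le> u v * (- (c v / 3))"
        using u(2)[OF v] by (rule mult_left_mono)
      also have "\<dots> \<le> u v0 * (- (c v / 3))"
        using u(1)[OF v0 v] 3 c(1)[OF v] by (intro mult_right_mono_neg) auto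
      also have "\<dots> \<le> u v0 * (H v - c v / 3)"
        using u0 H(1)[OF v] by (intro mult_left_mono) auto
      finally show ?thesis .
    qed
  qed
  then have "0 \<le> (\<Sum>v\<in>V. u v0 * (H v - c v / 3))"
    using gain by (meson order_trans sum_mono)
  also have "\<dots> = u v0 * ((\<Sum>v\<in>V. H v) - (\<Sum>v\<in>V. c v) / 3)"
    by (simp add: sum_distrib_left[symmetric] sum_subtractf sum_divide_distrib)
  finally show ?thesis using u0 by (simp add: zero_le_mult_iff)
next
  case True
  \<comment> \<open>Utility vanishes only at value 0, so all positive values are pooled in full.
    Then \<open>gain\<close> leaves no pooled mass at positive values, and a pool at 0 alone would
    violate \<open>mean\<close>; the pool is empty.\<close>
  then have v00: "v0 = 0" using u(3)[OF v0] V v0 by force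
  have le: "u v * (H v - 2 / 3 * c v) \<le> - (u v * c v / 3)" if v: "v \<in> V" for v
  proof (cases "v = v0")
    case False
    then have "v0 < v" using v V v00 by force
    then have "H v - 2 / 3 * c v \<le> - (c v / 3)" using H(2)[OF v] c(3)[OF v] by simp
    then show ?thesis using mult_left_mono[OF _ u(2)[OF v]] by fastforce
  qed (use True in simp)
  have "(\<Sum>v\<in>V. u v * c v / 3) \<le> 0"
    using order_trans[OF gain sum_mono[OF le]] by (simp add: sum_negf)
  moreover have "0 \<le> u v * c v / 3" if "v \<in> V" for v
    using that u(2) c(1) by simp
  ultimately have "u v * c v / 3 = 0" if "v \<in> V" for v
    using that V by (smt (verit) sum_nonneg_eq_0_iff sum_nonneg)
  then have c0: "c v = 0" if "v \<in> V" "v \<noteq> 0" for v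
    using that u(3)[of v] V by force
  have "(\<Sum>v\<in>V. c v * (v - \<theta>)) = (\<Sum>v\<in>{v0}. c v * (v - \<theta>))"
    using V v0 c0 v00 by (intro sum.mono_neutral_right) auto
  then have "c v0 = 0" using mean \<theta> c(1)[OF v0] v00 by (auto simp: mult_le_0_iff)
  then have "c v = 0" if "v \<in> V" for v using c0 v00 that by auto
  then show ?thesis using H(1) by (simp add: sum_nonneg)
qed

section \<open>The kernel of the pooling deviation\<close>

text \<open>Signals in \<open>B\<close> are merged and split again: label 0 is the pool, reached
  with probability \<open>r\<close>, and label 1 takes the rest. The shift by 2 keeps all other
  signals distinct from these two.\<close>

definition pool_kernel :: "nat set \<Rightarrow> real \<Rightarrow> nat pmf \<Rightarrow> nat pmf" where
  "pool_kernel B r K = bind_pmf K (\<lambda>s. if s \<in> B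
     then map_pmf (\<lambda>x. if x then 0 else 1) (bernoulli_pmf r) else return_pmf (s + 2))"

lemma expectation_pool_kernel:
  fixes g :: "nat \<Rightarrow> real"
  assumes r: "0 \<le> r" "r \<le> 1" and g: "\<And>s. \<bar>g s\<bar> \<le> C"
  shows "measure_pmf.expectation (pool_kernel B r K) g
       = measure_pmf.expectation K (\<lambda>s. if s \<in> B then r * g 0 + (1 - r) * g 1 else g (s + 2))"
  unfolding pool_kernel_def
  by (subst expectation_bind_pmf[where B = C])
     (use r g in \<open>auto intro!: Bochner_Integration.integral_cong\<close>)

lemma pmf_pool_kernel:
  assumes r: "0 \<le> r" "r \<le> 1"
  shows "pmf (pool_kernel B r K) 0 = r * measure_pmf.prob K B"
    "pmf (pool_kernel B r K) 1 = (1 - r) * measure_pmf.prob K B"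
    "pmf (pool_kernel B r K) (s + 2) = (if s \<in> B then 0 else pmf K s)"
proof -
  have *: "pmf (pool_kernel B r K) x = measure_pmf.expectation K
      (\<lambda>s. if s \<in> B then r * indicator {x} 0 + (1 - r) * indicator {x} 1 else indicator {x} (s + 2))" for x
    using expectation_pool_kernel[OF r, of "indicator {x}" 1 B K] by (simp add: measure_pmf_single)
  show "pmf (pool_kernel B r K) 0 = r * measure_pmf.prob K B"
  proof -
    have "(\<lambda>s. if s \<in> B then r * indicator {0::nat} 0 + (1 - r) * indicator {0} (1::nat) else indicator {0} (s + 2))
        = (\<lambda>s. r * indicator B s)" by (auto simp: indicator_def)
    then show ?thesis unfolding * by simp
  qed
  show "pmf (pool_kernel B r K) 1 = (1 - r) * measure_pmf.prob K B"
  proof -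
    have "(\<lambda>s. if s \<in> B then r * indicator {1::nat} 0 + (1 - r) * indicator {1} (1::nat) else indicator {1} (s + 2))
        = (\<lambda>s. (1 - r) * indicator B s)" by (auto simp: indicator_def)
    then show ?thesis unfolding * by simp
  qed
  show "pmf (pool_kernel B r K) (s + 2) = (if s \<in> B then 0 else pmf K s)"
  proof -
    have "(\<lambda>x. if x \<in> B then r * indicator {s + 2 :: nat} 0 + (1 - r) * indicator {s + 2} (1::nat)
        else indicator {s + 2} (x + 2)) = (\<lambda>x. if s \<in> B then 0 else indicator {s} x)"
      by (auto simp: indicator_def)
    then show ?thesis unfolding * by (simp add: measure_pmf_single)
  qed
qed

section \<open>Selection of the top agents\<close>

text \<open>Exchange argument: \<open>T - {..<k}\<close> and \<open>{..<k} - T\<close> have the same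
  size, and \<open>l (k - 1)\<close> separates their values.\<close>

lemma sum_le_sum_initial_segment:
  fixes l :: "nat \<Rightarrow> real"
  assumes anti: "\<And>i j. i \<le> j \<Longrightarrow> j < n \<Longrightarrow> l j \<le> l i"
    and T: "T \<subseteq> {..<n}" "card T = k" and k: "0 < k"
  shows "sum l T \<le> sum l {..<k}"
proof -
  have fin: "finite T" using T finite_subset by blast
  have kn: "k \<le> n" using T card_mono[of "{..<n}" T] by simp
  have "sum l (T - {..<k}) \<le> real (card (T - {..<k})) * l (k - 1)"
    using T k by (intro sum_bounded_above anti) auto
  also have "card (T - {..<k}) = card ({..<k} - T)"
    using card_Diff_subset_Int[of T "{..<k}"] card_Diff_subset_Int[of "{..<k}" T] T fin
    by (simp add: Int_commute)
  also have "real (card ({..<k} - T)) * l (k - 1) \<le> sum l ({..<k} - T)"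
    using kn k by (intro sum_bounded_below anti) auto
  finally have "sum l (T - {..<k}) \<le> sum l ({..<k} - T)" .
  moreover have "sum l T = sum l (T - {..<k}) + sum l (T \<inter> {..<k})"
    using fin by (metis add.commute sum.Int_Diff)
  moreover have "sum l {..<k} = sum l ({..<k} - T) + sum l (T \<inter> {..<k})"
    by (metis add.commute sum.Int_Diff finite_lessThan Int_commute)
  ultimately show ?thesis by linarith
qed

context persuasion_game
begin

lemma finite_k_subsets: "finite k_subsets"
  by (rule finite_subset[of _ "Pow {..<N}"]) (auto simp: k_subsets_def)

lemma k_subsets_nonempty: "k_subsets \<noteq> {}"
  using obtain_subset_with_card_n[of k "{..<N}"] k_le_N by (force simp: k_subsets_def)

text \<open>A \<open>k\<close>-subset of maximal sum is a top set, since exchanging a member for a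
  better outsider would raise the sum. Nonemptiness gives \<open>pmf_of_set\<close> its
  meaning.\<close>

lemma top_sets_nonempty: "top_sets e \<noteq> {}"
proof -
  obtain S where S: "S \<in> k_subsets" and max: "\<And>S'. S' \<in> k_subsets \<Longrightarrow> sum e S' \<le> sum e S"
  proof -
    have "Max (sum e ` k_subsets) \<in> sum e ` k_subsets"
      using finite_k_subsets k_subsets_nonempty by (intro Max_in) auto
    then obtain S where S: "S \<in> k_subsets" and eq: "Max (sum e ` k_subsets) = sum e S" by blast
    show thesis
      by (rule that[OF S]) (use finite_k_subsets in \<open>simp flip: eq\<close>)
  qed
  have fin: "finite S" using S finite_subset by (auto simp: k_subsets_def)
  have "e j \<le> e i" if ij: "i \<in> S" "j \<in> {..<N} - S" for i j
  proof -
    have "insert j (S - {i}) \<in> k_subsets"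
      using S ij fin k_ge_1 by (auto simp: k_subsets_def)
    from max[OF this] show ?thesis using ij fin by (simp add: sum_diff1)
  qed
  then show ?thesis using S by (auto simp: top_sets_def)
qed

lemma finite_top_sets: "finite (top_sets e)"
  using finite_k_subsets by (auto simp: top_sets_def)

lemma set_pmf_top_sets: "set_pmf (pmf_of_set (top_sets e)) = top_sets e"
  by (intro set_pmf_of_set top_sets_nonempty finite_top_sets)

lemma selection_prob_bounds: "0 \<le> selection_prob e i" "selection_prob e i \<le> 1"
  by (auto simp: selection_prob_def)

text \<open>Linearity of expectation over the random top set. Weights 1 give the total
  \<open>k\<close>, and weights \<open>e\<close> the comparison with welfare.\<close>

lemma sum_selection_prob:
  "(\<Sum>i<N. selection_prob e i * w i)
     = measure_pmf.expectation (pmf_of_set (top_sets e)) (\<lambda>S. \<Sum>i\<in>S. w i)"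
proof -
  let ?P = "pmf_of_set (top_sets e)"
  have int: "integrable (measure_pmf ?P) f" for f :: "nat set \<Rightarrow> real"
    by (rule integrable_measure_pmf_finite) (simp add: set_pmf_top_sets finite_top_sets)
  have "(\<Sum>i<N. selection_prob e i * w i)
      = (\<Sum>i<N. measure_pmf.expectation ?P (\<lambda>S. indicator {S. i \<in> S} S * w i))"
    by (simp add: selection_prob_def)
  also have "\<dots> = measure_pmf.expectation ?P (\<lambda>S. \<Sum>i<N. indicator {S. i \<in> S} S * w i)"
    by (rule Bochner_Integration.integral_sum[symmetric]) (rule int)
  also have "\<dots> = measure_pmf.expectation ?P (\<lambda>S. \<Sum>i\<in>S. w i)"
  proof (rule expectation_cong_pmf)
    fix S assume "S \<in> set_pmf ?P"
    then have "S \<subseteq> {..<N}" unfolding set_pmf_top_sets by (simp add: top_sets_def k_subsets_def)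
    then show "(\<Sum>i<N. indicator {S. i \<in> S} S * w i) = (\<Sum>i\<in>S. w i)"
      by (intro sum.mono_neutral_cong_right) (auto simp: indicator_def)
  qed
  finally show ?thesis .
qed

lemma sum_selection_prob_eq_k: "(\<Sum>i<N. selection_prob e i) = k"
proof -
  have "measure_pmf.expectation (pmf_of_set (top_sets e)) (\<lambda>S. \<Sum>i\<in>S. 1 :: real)
      = measure_pmf.expectation (pmf_of_set (top_sets e)) (\<lambda>S. real k)"
    by (rule expectation_cong_pmf) (simp only: set_pmf_top_sets, simp add: top_sets_def k_subsets_def)
  then show ?thesis using sum_selection_prob[of e "\<lambda>_. 1"] by simp
qed

text \<open>A top set without \<open>i\<close> would consist of \<open>k\<close> other agents whose
  means are at least \<open>e i\<close>. Ties are counted against \<open>i\<close>, so the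
  tie-breaking cannot matter.\<close>

lemma selection_prob_eq_1:
  assumes i: "i < N" and few: "card {j. j < N \<and> j \<noteq> i \<and> e i \<le> e j} < k"
  shows "selection_prob e i = 1"
proof -
  have "i \<in> S" if S: "S \<in> top_sets e" for S
  proof (rule ccontr)
    assume "i \<notin> S"
    then have "S \<subseteq> {j. j < N \<and> j \<noteq> i \<and> e i \<le> e j}"
      using S i by (auto simp: top_sets_def k_subsets_def)
    then have "card S \<le> card {j. j < N \<and> j \<noteq> i \<and> e i \<le> e j}" by (intro card_mono) auto
    then show False using few S by (simp add: top_sets_def k_subsets_def)
  qed
  then show ?thesis
    unfolding selection_prob_def
    by (intro measure_pmf.prob_eq_1[THEN iffD2]) (auto simp: AE_measure_pmf_iff set_pmf_top_sets)
qed

text \<open>Sorting the agents by \<open>e\<close>, rather than the values, remembers who holds each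
  rank: \<open>q j\<close> is an agent of rank \<open>j\<close>.\<close>

lemma order_stat_enumeration:
  obtains q where "bij_betw q {..<N} {..<N}" "\<And>j. j < N \<Longrightarrow> order_stat e j = e (q j)"
    "\<And>i j. i \<le> j \<Longrightarrow> j < N \<Longrightarrow> order_stat e j \<le> order_stat e i"
proof -
  define xs where "xs = rev (sort_key e [0..<N])"
  have len: "length xs = N" by (simp add: xs_def)
  have srt: "sort (map e [0..<N]) = map e (sort_key e [0..<N])"
    by (intro properties_for_sort) (simp_all add: mset_map)
  have os: "order_stat e j = e (xs ! j)" if "j < N" for j
    using that len unfolding order_stat_def srt rev_map xs_def[symmetric] by simp
  have "sorted (rev (map e xs))"
    unfolding xs_def rev_map[symmetric] rev_rev_ident by simp
  then have "e (xs ! j) \<le> e (xs ! i)" if "i \<le> j" "j < N" for i j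
    using sorted_rev_nth_mono[of "map e xs" i j] that len by simp
  moreover have "bij_betw (\<lambda>j. xs ! j) {..<N} {..<N}"
    using len by (intro bij_betw_nth) (auto simp: xs_def)
  ultimately show thesis using os by (intro that[of "\<lambda>j. xs ! j"]) auto
qed

text \<open>Pulled back along \<open>q\<close>, the set \<open>S\<close> becomes a set of
  \<open>k\<close> ranks, and the first \<open>k\<close> ranks have the largest sum.\<close>

lemma sum_le_sum_order_stat:
  assumes S: "S \<in> k_subsets"
  shows "sum e S \<le> (\<Sum>j<k. order_stat e j)"
proof -
  obtain q where q: "bij_betw q {..<N} {..<N}" "\<And>j. j < N \<Longrightarrow> order_stat e j = e (q j)"
    "\<And>i j. i \<le> j \<Longrightarrow> j < N \<Longrightarrow> order_stat e j \<le> order_stat e i"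
    using order_stat_enumeration[of e] by blast
  define T where "T = {j. j < N \<and> q j \<in> S}"
  have "q ` T = S"
    using S bij_betw_imp_surj_on[OF q(1)] unfolding T_def k_subsets_def by auto
  then have bij: "bij_betw q T S"
    using q(1) by (auto simp: bij_betw_def T_def inj_on_def)
  have "sum e S = (\<Sum>j\<in>T. e (q j))" using sum.reindex_bij_betw[OF bij, of e] by simp
  also have "\<dots> = sum (order_stat e) T" using q(2) by (intro sum.cong) (auto simp: T_def)
  also have "\<dots> \<le> sum (order_stat e) {..<k}"
    using q(3) S k_ge_1 bij_betw_same_card[OF bij]
    by (intro sum_le_sum_initial_segment[where n = N]) (auto simp: T_def k_subsets_def)
  finally show ?thesis .
qed

lemma sum_order_stat_bounds:
  assumes "\<And>i. i < N \<Longrightarrow> 0 \<le> e i" "\<And>i. i < N \<Longrightarrow> e i \<le> 1"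
  shows "0 \<le> (\<Sum>j<k. order_stat e j)" "(\<Sum>j<k. order_stat e j) \<le> k"
proof -
  obtain q where q: "bij_betw q {..<N} {..<N}" "\<And>j. j < N \<Longrightarrow> order_stat e j = e (q j)"
    "\<And>i j. i \<le> j \<Longrightarrow> j < N \<Longrightarrow> order_stat e j \<le> order_stat e i"
    using order_stat_enumeration[of e] by blast
  have qN: "q j < N" if "j < k" for j
    using bij_betw_apply[OF q(1), of j] that k_le_N by simp
  show "0 \<le> (\<Sum>j<k. order_stat e j)"
    using q(2) qN assms k_le_N by (intro sum_nonneg) auto
  have "(\<Sum>j<k. order_stat e j) \<le> (\<Sum>j<k. 1)"
    using q(2) qN assms k_le_N by (intro sum_mono) auto
  then show "(\<Sum>j<k. order_stat e j) \<le> k" by simp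
qed

lemma sum_selection_prob_means_le: "(\<Sum>i<N. selection_prob e i * e i) \<le> (\<Sum>j<k. order_stat e j)"
proof -
  have "sum e S \<le> (\<Sum>j<k. order_stat e j)" if "S \<in> top_sets e" for S
    using that by (intro sum_le_sum_order_stat) (auto simp: top_sets_def)
  then show ?thesis
    unfolding sum_selection_prob
    by (intro measure_pmf.integral_le_const integrable_measure_pmf_finite)
       (auto simp: AE_measure_pmf_iff set_pmf_top_sets finite_top_sets)
qed

section \<open>Posterior means and utilities\<close>

lemma value_signal_support:
  assumes "i < N" "x \<in> set_pmf (value_signal i Z)"
  shows "fst x \<in> V" "0 \<le> fst x" "fst x \<le> 1"
  using assms prior_support[of i] V_unit by (auto simp: value_signal_def)

abbreviation signal_law :: "nat \<Rightarrow> scheme \<Rightarrow> nat pmf" where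
  "signal_law i Z \<equiv> map_pmf snd (value_signal i Z)"

lemma set_pmf_cond_value_signal:
  assumes "s \<in> set_pmf (signal_law i Z)"
  shows "set_pmf (cond_pmf (value_signal i Z) {x. snd x = s})
       = set_pmf (value_signal i Z) \<inter> {x. snd x = s}"
  using assms by (intro set_cond_pmf) auto

lemma posterior_support:
  assumes "i < N" "s \<in> set_pmf (signal_law i Z)"
  shows "set_pmf (posterior i Z s) \<subseteq> V"
  using assms(1) value_signal_support(1) unfolding posterior_def set_map_pmf set_pmf_cond_value_signal[OF assms(2)]
  by auto

lemma posterior_mean_bounds:
  assumes "i < N" "s \<in> set_pmf (signal_law i Z)"
  shows "0 \<le> posterior_mean i Z s" "posterior_mean i Z s \<le> 1"
proof -
  have "v \<in> {0..1}" if "v \<in> set_pmf (posterior i Z s)" for v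
    using posterior_support[OF assms] V_unit that by blast
  then show "0 \<le> posterior_mean i Z s" "posterior_mean i Z s \<le> 1"
    unfolding posterior_mean_def by (intro expectation_bounds_pmf[where a = 0 and b = 1]; simp)+
qed

lemma u_bounds:
  assumes "i < N" "v \<in> V"
  shows "0 \<le> u i v" "u i v \<le> u i 1"
  using assms V_unit u_nonneg[of i v] monotone_onD[OF u_mono[of i], of v 1] by auto

lemma posterior_utility_bounds:
  assumes "i < N" "s \<in> set_pmf (signal_law i Z)"
  shows "0 \<le> posterior_utility i Z s" "posterior_utility i Z s \<le> u i 1"
proof -
  have "v \<in> V" if "v \<in> set_pmf (posterior i Z s)" for v
    using posterior_support[OF assms] that by blast
  then show "0 \<le> posterior_utility i Z s" "posterior_utility i Z s \<le> u i 1"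
    unfolding posterior_utility_def using u_bounds[OF assms(1)]
    by (intro expectation_bounds_pmf[where a = 0 and b = "u i 1"]; simp)+
qed

text \<open>Disintegration: drawing the signal first and the pair from its conditional law restores
  the joint law.\<close>

lemma bind_signal_law_cond:
  "bind_pmf (signal_law i Z) (\<lambda>s. cond_pmf (value_signal i Z) {x. snd x = s}) = value_signal i Z"
proof (rule bind_cond_pmf_cancel)
  fix s and y :: "real \<times> nat" assume "snd y = s"
  then have "{x. snd y = x} = {s}" by auto
  then show "measure_pmf.prob (value_signal i Z) {y. snd y = s}
      = measure_pmf.prob (signal_law i Z) {x. snd y = x}"
    by (simp add: vimage_def)
qed auto

text \<open>Tower property: given the signal \<open>s\<close>, the factor \<open>\<phi> s\<close> is
  constant and \<open>w\<close> averages over the posterior.\<close>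

lemma expectation_posterior:
  fixes \<phi> :: "nat \<Rightarrow> real" and w :: "real \<Rightarrow> real"
  assumes i: "i < N" and \<phi>: "\<And>s. \<bar>\<phi> s\<bar> \<le> B" and w: "\<And>v. v \<in> V \<Longrightarrow> \<bar>w v\<bar> \<le> C"
  shows "measure_pmf.expectation (value_signal i Z) (\<lambda>x. \<phi> (snd x) * w (fst x))
       = measure_pmf.expectation (signal_law i Z)
           (\<lambda>s. \<phi> s * measure_pmf.expectation (posterior i Z s) w)"
proof -
  have bd: "\<bar>\<phi> (snd x) * w (fst x)\<bar> \<le> B * C" if "x \<in> set_pmf (value_signal i Z)" for x
    using value_signal_support(1)[OF i that] \<phi> w
    unfolding abs_mult by (meson abs_ge_zero mult_mono order_trans)
  have "measure_pmf.expectation (value_signal i Z) (\<lambda>x. \<phi> (snd x) * w (fst x))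
      = measure_pmf.expectation (signal_law i Z) (\<lambda>s. measure_pmf.expectation
          (cond_pmf (value_signal i Z) {x. snd x = s}) (\<lambda>x. \<phi> (snd x) * w (fst x)))"
    by (subst (1) bind_signal_law_cond[symmetric])
       (rule expectation_bind_pmf[where B = "B * C"], use bd in \<open>simp only: bind_signal_law_cond\<close>)
  also have "\<dots> = measure_pmf.expectation (signal_law i Z)
           (\<lambda>s. \<phi> s * measure_pmf.expectation (posterior i Z s) w)"
  proof (rule expectation_cong_pmf)
    fix s assume "s \<in> set_pmf (signal_law i Z)"
    then have "measure_pmf.expectation (cond_pmf (value_signal i Z) {x. snd x = s}) (\<lambda>x. \<phi> (snd x) * w (fst x))
      = measure_pmf.expectation (cond_pmf (value_signal i Z) {x. snd x = s}) (\<lambda>x. \<phi> s * w (fst x))"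
      by (intro expectation_cong_pmf) (auto simp: set_pmf_cond_value_signal)
    then show "measure_pmf.expectation (cond_pmf (value_signal i Z) {x. snd x = s}) (\<lambda>x. \<phi> (snd x) * w (fst x))
      = \<phi> s * measure_pmf.expectation (posterior i Z s) w"
      by (simp add: posterior_def)
  qed
  finally show ?thesis .
qed

lemma expectation_value_signal:
  fixes g :: "real \<Rightarrow> nat \<Rightarrow> real"
  assumes i: "i < N" and g: "\<And>v s. v \<in> V \<Longrightarrow> \<bar>g v s\<bar> \<le> B"
  shows "measure_pmf.expectation (value_signal i Z) (\<lambda>x. g (fst x) (snd x))
       = (\<Sum>v\<in>V. pmf (F i) v * measure_pmf.expectation (kernel Z v) (g v))"
proof -
  have vs: "value_signal i Z = bind_pmf (F i) (\<lambda>v. map_pmf (Pair v) (kernel Z v))"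
    by (simp add: value_signal_def map_pmf_def)
  have "measure_pmf.expectation (value_signal i Z) (\<lambda>x. g (fst x) (snd x))
      = measure_pmf.expectation (F i) (\<lambda>v. measure_pmf.expectation (kernel Z v) (g v))"
    unfolding vs using g prior_support[OF i]
    by (subst expectation_bind_pmf[where B = B]) auto
  also have "\<dots> = (\<Sum>v\<in>V. pmf (F i) v * measure_pmf.expectation (kernel Z v) (g v))"
    using prior_support[OF i] finite_V
    by (subst integral_measure_pmf[of V]) auto
  finally show ?thesis .
qed

section \<open>Payoffs against random rivals\<close>

text \<open>Joint law of the realized scheme and the signal of one agent. It puts mixing and
  signaling into a single random coordinate, and these coordinates are independent across
  agents.\<close>

definition agent_law :: "(nat \<Rightarrow> scheme pmf) \<Rightarrow> nat \<Rightarrow> (scheme \<times> nat) pmf" where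
  "agent_law M i = bind_pmf (M i) (\<lambda>Z. map_pmf (Pair Z) (signal_law i Z))"

definition profile_law :: "(nat \<Rightarrow> scheme pmf) \<Rightarrow> (nat \<Rightarrow> scheme \<times> nat) pmf" where
  "profile_law M = Pi_pmf {..<N} (undefined, 0) (agent_law M)"

definition means :: "(nat \<Rightarrow> scheme \<times> nat) \<Rightarrow> nat \<Rightarrow> real" where
  "means f i = posterior_mean i (fst (f i)) (snd (f i))"

definition rivals_law :: "(nat \<Rightarrow> scheme pmf) \<Rightarrow> nat \<Rightarrow> (nat \<Rightarrow> scheme \<times> nat) pmf" where
  "rivals_law M i = Pi_pmf ({..<N} - {i}) (undefined, 0) (agent_law M)"

text \<open>Selection probability of a signal with posterior mean \<open>y\<close>, averaged over
  the mixing and the signals of the rivals. A scheme of agent \<open>i\<close> enters only through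
  \<open>y\<close>.\<close>

definition win_prob :: "(nat \<Rightarrow> scheme pmf) \<Rightarrow> nat \<Rightarrow> real \<Rightarrow> real" where
  "win_prob M i y = measure_pmf.expectation (rivals_law M i) (\<lambda>f. selection_prob ((means f)(i := y)) i)"

lemma agent_law_support:
  "(Z, s) \<in> set_pmf (agent_law M i) \<longleftrightarrow> Z \<in> set_pmf (M i) \<and> s \<in> set_pmf (signal_law i Z)"
  by (auto simp: agent_law_def simp del: set_map_pmf) (auto)

lemma profile_law_support:
  assumes "f \<in> set_pmf (profile_law M)" "i < N"
  shows "f i \<in> set_pmf (agent_law M i)" "snd (f i) \<in> set_pmf (signal_law i (fst (f i)))"
proof -
  show *: "f i \<in> set_pmf (agent_law M i)"
    using assms by (auto simp: profile_law_def set_Pi_pmf PiE_dflt_def)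
  show "snd (f i) \<in> set_pmf (signal_law i (fst (f i)))"
    using * agent_law_support[of "fst (f i)" "snd (f i)"] by simp
qed

lemma means_bounds:
  assumes "f \<in> set_pmf (profile_law M)" "i < N"
  shows "0 \<le> means f i" "means f i \<le> 1"
  unfolding means_def using profile_law_support(2)[OF assms] assms(2)
  by (auto intro: posterior_mean_bounds simp del: set_map_pmf)

lemma expectation_agent_law:
  fixes \<psi> :: "scheme \<times> nat \<Rightarrow> real"
  assumes "\<And>z. z \<in> set_pmf (agent_law M i) \<Longrightarrow> \<bar>\<psi> z\<bar> \<le> B"
  shows "measure_pmf.expectation (agent_law M i) \<psi>
       = measure_pmf.expectation (M i) (\<lambda>Z. measure_pmf.expectation (signal_law i Z) (\<lambda>s. \<psi> (Z, s)))"
  using expectation_bind_pmf[of "M i" "\<lambda>Z. map_pmf (Pair Z) (signal_law i Z)" \<psi> B] assms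
  unfolding agent_law_def by simp

lemma profile_law_bind:
  "profile_law M = bind_pmf (realized_profile M)
     (\<lambda>Z. Pi_pmf {..<N} (undefined, 0) (\<lambda>j. map_pmf (Pair (Z j)) (signal_law j (Z j))))"
  unfolding profile_law_def agent_law_def realized_profile_def
  by (rule Pi_pmf_bind) simp

text \<open>Drawing all schemes first and then all signals has the same law as drawing independent
  scheme-signal pairs.\<close>

lemma expectation_profile_law:
  fixes \<Phi> :: "(nat \<Rightarrow> scheme) \<Rightarrow> (nat \<Rightarrow> nat) \<Rightarrow> real"
  assumes B: "\<And>f. f \<in> set_pmf (profile_law M) \<Longrightarrow> \<bar>\<Phi> (fst \<circ> f) (snd \<circ> f)\<bar> \<le> B"
  shows "measure_pmf.expectation (realized_profile M)
           (\<lambda>Z. measure_pmf.expectation (signal_profile Z) (\<Phi> Z))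
       = measure_pmf.expectation (profile_law M) (\<lambda>f. \<Phi> (fst \<circ> f) (snd \<circ> f))"
proof -
  let ?Q = "\<lambda>Z. Pi_pmf {..<N} (undefined, 0) (\<lambda>j. map_pmf (Pair (Z j)) (signal_law j (Z j)))"
  have "measure_pmf.expectation (profile_law M) (\<lambda>f. \<Phi> (fst \<circ> f) (snd \<circ> f))
      = measure_pmf.expectation (realized_profile M)
          (\<lambda>Z. measure_pmf.expectation (?Q Z) (\<lambda>f. \<Phi> (fst \<circ> f) (snd \<circ> f)))"
    unfolding profile_law_bind
    by (rule expectation_bind_pmf[where B = B]) (rule B, simp only: profile_law_bind)
  also have "\<dots> = measure_pmf.expectation (realized_profile M)
           (\<lambda>Z. measure_pmf.expectation (signal_profile Z) (\<Phi> Z))"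
  proof (rule expectation_cong_pmf)
    fix Z assume Z: "Z \<in> set_pmf (realized_profile M)"
    \<comment> \<open>Outside \<open>{..<N}\<close> both sides are \<open>undefined\<close>; the
      default \<open>(undefined, 0)\<close> combines the defaults of the two stages.\<close>
    have "fst \<circ> f = Z" if "f \<in> set_pmf (?Q Z)" for f
    proof
      fix j
      show "(fst \<circ> f) j = Z j"
        using that Z by (cases "j < N")
          (auto simp: set_Pi_pmf PiE_dflt_def realized_profile_def)
    qed
    then have "measure_pmf.expectation (?Q Z) (\<lambda>f. \<Phi> (fst \<circ> f) (snd \<circ> f))
        = measure_pmf.expectation (?Q Z) (\<lambda>f. \<Phi> Z (snd \<circ> f))"
      by (intro expectation_cong_pmf) simp
    also have "\<dots> = measure_pmf.expectation (map_pmf (\<lambda>f. snd \<circ> f) (?Q Z)) (\<Phi> Z)" by simp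
    also have "map_pmf (\<lambda>f. snd \<circ> f) (?Q Z) = signal_profile Z"
      unfolding signal_profile_def
      by (subst Pi_pmf_map[symmetric, where dflt' = 0]) (auto simp: pmf.map_comp o_def)
    finally show "measure_pmf.expectation (?Q Z) (\<lambda>f. \<Phi> (fst \<circ> f) (snd \<circ> f))
        = measure_pmf.expectation (signal_profile Z) (\<Phi> Z)" .
  qed
  finally show ?thesis ..
qed

lemma means_eq_posterior_means: "means f = posterior_means (fst \<circ> f) (snd \<circ> f)"
  by (auto simp: means_def posterior_means_def)

lemma SW_eq: "SW M = measure_pmf.expectation (profile_law M) (\<lambda>f. \<Sum>j<k. order_stat (means f) j)"
proof -
  have "\<bar>\<Sum>j<k. order_stat (means f) j\<bar> \<le> k" if "f \<in> set_pmf (profile_law M)" for f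
    using sum_order_stat_bounds[of "means f"] means_bounds[OF that] by auto
  then show ?thesis
    unfolding SW_def pure_SW_def means_eq_posterior_means
    by (intro expectation_profile_law[where B = k]) simp
qed

lemma win_prob_bounds: "0 \<le> win_prob M i y" "win_prob M i y \<le> 1"
  unfolding win_prob_def by (intro expectation_bounds_pmf[where a = 0 and b = 1] selection_prob_bounds)+

lemma win_prob_deviation: "win_prob (M(i := \<tau>)) i = win_prob M i"
proof -
  have "rivals_law (M(i := \<tau>)) i = rivals_law M i"
    unfolding rivals_law_def by (rule Pi_pmf_cong) (auto simp: agent_law_def)
  then show ?thesis by (simp add: win_prob_def fun_eq_iff)
qed

lemma profile_law_split:
  assumes "i < N"
  shows "profile_law M
       = bind_pmf (agent_law M i) (\<lambda>z. map_pmf (\<lambda>f. f(i := z)) (rivals_law M i))"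
proof -
  have "{..<N} = insert i ({..<N} - {i})" using assms by auto
  then show ?thesis
    unfolding profile_law_def rivals_law_def map_pmf_def
    using Pi_pmf_insert'[of "{..<N} - {i}" i "(undefined, 0)" "agent_law M"] by simp
qed

text \<open>The coordinate of agent \<open>i\<close> is independent of its rivals. Averaging over
  them first turns the selection probability into \<open>win_prob\<close> at the agent's own
  posterior mean.\<close>

lemma expectation_selection_prob:
  fixes \<psi> :: "scheme \<times> nat \<Rightarrow> real"
  assumes i: "i < N" and \<psi>: "\<And>z. z \<in> set_pmf (agent_law M i) \<Longrightarrow> \<bar>\<psi> z\<bar> \<le> B"
  shows "measure_pmf.expectation (profile_law M) (\<lambda>f. selection_prob (means f) i * \<psi> (f i))
       = measure_pmf.expectation (M i) (\<lambda>Z. measure_pmf.expectation (signal_law i Z)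
           (\<lambda>s. win_prob M i (posterior_mean i Z s) * \<psi> (Z, s)))"
proof -
  have bd: "\<bar>selection_prob (means f) i * \<psi> (f i)\<bar> \<le> B" if "f \<in> set_pmf (profile_law M)" for f
  proof -
    have "\<bar>\<psi> (f i)\<bar> \<le> B" using \<psi> profile_law_support(1)[OF that i] by blast
    then show ?thesis
      using mult_mono[of "\<bar>selection_prob (means f) i\<bar>" 1 "\<bar>\<psi> (f i)\<bar>" B] selection_prob_bounds[of "means f" i]
      by (simp add: abs_mult)
  qed
  have upd: "means (f(i := z)) = (means f)(i := posterior_mean i (fst z) (snd z))" for f z
    by (auto simp: means_def)
  have "measure_pmf.expectation (profile_law M) (\<lambda>f. selection_prob (means f) i * \<psi> (f i))
      = measure_pmf.expectation (agent_law M i)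
          (\<lambda>z. win_prob M i (posterior_mean i (fst z) (snd z)) * \<psi> z)"
    unfolding profile_law_split[OF i]
    by (subst expectation_bind_pmf[where B = B])
       (use bd in \<open>simp_all only: profile_law_split[OF i], simp_all add: upd win_prob_def\<close>)
  also have "\<dots> = measure_pmf.expectation (M i) (\<lambda>Z. measure_pmf.expectation (signal_law i Z)
           (\<lambda>s. win_prob M i (posterior_mean i Z s) * \<psi> (Z, s)))"
  proof (subst expectation_agent_law[where B = B])
    fix z assume "z \<in> set_pmf (agent_law M i)"
    then show "\<bar>win_prob M i (posterior_mean i (fst z) (snd z)) * \<psi> z\<bar> \<le> B"
      using mult_mono[of "\<bar>win_prob M i (posterior_mean i (fst z) (snd z))\<bar>" 1 "\<bar>\<psi> z\<bar>" B]
        win_prob_bounds[of M i] \<psi>[of z]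
      by (simp add: abs_mult)
  qed simp
  finally show ?thesis .
qed

section \<open>Payoffs of deviations and best responses\<close>

definition scheme_payoff :: "(nat \<Rightarrow> scheme pmf) \<Rightarrow> nat \<Rightarrow> scheme \<Rightarrow> real" where
  "scheme_payoff M i Z = measure_pmf.expectation (signal_law i Z)
     (\<lambda>s. win_prob M i (posterior_mean i Z s) * posterior_utility i Z s)"

lemma payoff_deviation:
  assumes i: "i < N"
  shows "payoff i (M(i := \<tau>)) = measure_pmf.expectation \<tau> (scheme_payoff M i)"
proof -
  let ?M = "M(i := \<tau>)"
  have bd: "\<bar>posterior_utility i (fst z) (snd z)\<bar> \<le> u i 1" if "z \<in> set_pmf (agent_law ?M i)" for z
    using that posterior_utility_bounds[OF i, of "snd z" "fst z"]
      agent_law_support[of "fst z" "snd z" ?M i] by simp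
  have bd': "\<bar>selection_prob (means f) i * posterior_utility i (fst (f i)) (snd (f i))\<bar> \<le> u i 1"
    if "f \<in> set_pmf (profile_law ?M)" for f
    using mult_mono[of "\<bar>selection_prob (means f) i\<bar>" 1
        "\<bar>posterior_utility i (fst (f i)) (snd (f i))\<bar>" "u i 1"]
      selection_prob_bounds[of "means f" i] bd[OF profile_law_support(1)[OF that i]]
    by (simp add: abs_mult)
  have "payoff i ?M = measure_pmf.expectation (profile_law ?M)
      (\<lambda>f. selection_prob (means f) i * posterior_utility i (fst (f i)) (snd (f i)))"
    unfolding payoff_def pure_payoff_def means_eq_posterior_means
    using expectation_profile_law[of ?M "\<lambda>Z \<sigma>. selection_prob (posterior_means Z \<sigma>) i
        * posterior_utility i (Z i) (\<sigma> i)" "u i 1"] bd'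
    by (simp add: means_eq_posterior_means)
  also have "\<dots> = measure_pmf.expectation \<tau> (scheme_payoff M i)"
    using expectation_selection_prob[OF i, of ?M "\<lambda>z. posterior_utility i (fst z) (snd z)" "u i 1"] bd
    by (simp add: scheme_payoff_def[abs_def] win_prob_deviation del: integral_map_pmf)
  finally show ?thesis .
qed

lemma scheme_payoff_bounds:
  assumes i: "i < N"
  shows "0 \<le> scheme_payoff M i Z" "scheme_payoff M i Z \<le> u i 1"
proof -
  have "0 \<le> win_prob M i y * posterior_utility i Z s \<and> win_prob M i y * posterior_utility i Z s \<le> u i 1"
    if "s \<in> set_pmf (signal_law i Z)" for s y
    using mult_mono[OF win_prob_bounds(2)[of M i y] posterior_utility_bounds(2)[OF i that]]
      win_prob_bounds(1)[of M i y] posterior_utility_bounds(1)[OF i that] by simp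
  then show "0 \<le> scheme_payoff M i Z" "scheme_payoff M i Z \<le> u i 1"
    unfolding scheme_payoff_def
    by (intro expectation_bounds_pmf[where a = 0 and b = "u i 1"]; blast)+
qed

text \<open>No pure scheme beats the equilibrium payoff \<open>P\<close>, while \<open>P\<close> is
  the average payoff over the support of \<open>M i\<close>. A nonnegative gap of mean zero vanishes
  on the support, so every scheme in use attains \<open>P\<close>.\<close>

lemma equilibrium_best_response:
  assumes eq: "nash_equilibrium M" and i: "i < N" and Z: "Z \<in> set_pmf (M i)"
    and Z': "Z' \<in> pure_strategies i"
  shows "scheme_payoff M i Z' \<le> scheme_payoff M i Z"
proof -
  have sub: "set_pmf (M i) \<subseteq> pure_strategies i"
    using eq i by (simp add: nash_equilibrium_def mixed_profile_def)
  define P where "P = measure_pmf.expectation (M i) (scheme_payoff M i)"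
  have P: "scheme_payoff M i Y \<le> P" if "Y \<in> pure_strategies i" for Y
  proof -
    \<comment> \<open>Writing the equilibrium itself as the trivial deviation
      \<open>M(i := M i)\<close> lets \<open>payoff_deviation\<close> evaluate both sides.\<close>
    have "payoff i (M(i := return_pmf Y)) \<le> payoff i (M(i := M i))"
      using eq i that by (simp add: nash_equilibrium_def)
    then show ?thesis unfolding payoff_deviation[OF i] P_def by simp
  qed
  have int: "integrable (measure_pmf (M i)) (scheme_payoff M i)"
    using scheme_payoff_bounds[OF i] by (intro integrable_pmf_bounded[where B = "u i 1"]) auto
  have "measure_pmf.expectation (M i) (\<lambda>Y. P - scheme_payoff M i Y) = 0"
    using int by (simp add: P_def)
  moreover have "AE Y in measure_pmf (M i). 0 \<le> P - scheme_payoff M i Y"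
    using P sub by (auto simp: AE_measure_pmf_iff)
  ultimately have "AE Y in measure_pmf (M i). P - scheme_payoff M i Y = 0"
    using int by (subst (asm) integral_nonneg_eq_0_iff_AE) auto
  then have "scheme_payoff M i Z = P" using Z by (auto simp: AE_measure_pmf_iff)
  then show ?thesis using P[OF Z'] by simp
qed

text \<open>Markov's inequality for the \<open>k\<close>-th largest posterior mean.\<close>

lemma win_prob_ge:
  assumes i: "i < N" and \<theta>: "0 < \<theta>" "\<theta> \<le> y"
  shows "1 - SW M / (real k * \<theta>) \<le> win_prob M i y"
proof -
  \<comment> \<open>All agents are counted, \<open>i\<close> included: the event forces welfare at
    least \<open>real k * \<theta>\<close>, and when it fails, fewer than \<open>k\<close> rivals
    reach \<open>y\<close>, as \<open>\<theta> \<le> y\<close>.\<close>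
  define many where "many f \<longleftrightarrow> k \<le> card {j. j < N \<and> \<theta> \<le> means f j}" for f
  have "real k * \<theta> * indicator {f. many f} f \<le> (\<Sum>j<k. order_stat (means f) j)"
    if f: "f \<in> set_pmf (profile_law M)" for f
  proof (cases "many f")
    case True
    then obtain S where S: "S \<subseteq> {j. j < N \<and> \<theta> \<le> means f j}" "card S = k"
      unfolding many_def by (metis obtain_subset_with_card_n)
    then have "real k * \<theta> \<le> sum (means f) S"
      using sum_bounded_below[of S \<theta> "means f"] by auto
    also have "\<dots> \<le> (\<Sum>j<k. order_stat (means f) j)"
      using S by (intro sum_le_sum_order_stat) (auto simp: k_subsets_def)
    finally show ?thesis using True by (simp add: indicator_def)
  next
    case False
    then show ?thesis
      using sum_order_stat_bounds(1)[of "means f"] means_bounds[OF f] by simp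
  qed
  moreover have "\<bar>\<Sum>j<k. order_stat (means f) j\<bar> \<le> k" if "f \<in> set_pmf (profile_law M)" for f
    using sum_order_stat_bounds[of "means f"] means_bounds[OF that] by auto
  ultimately have "measure_pmf.expectation (profile_law M) (\<lambda>f. real k * \<theta> * indicator {f. many f} f) \<le> SW M"
    unfolding SW_eq using \<theta>
    by (intro expectation_mono_pmf[where A = "real k * \<theta>" and B = k]) (auto simp: indicator_def)
  then have markov: "measure_pmf.prob (profile_law M) {f. many f} \<le> SW M / (real k * \<theta>)"
    using \<theta> k_ge_1 by (simp add: pos_le_divide_eq mult.commute)
  \<comment> \<open>Erasing coordinate \<open>i\<close> of a full profile couples the rivals to the
    profile whose welfare Markov's inequality controls.\<close>
  have rivals: "rivals_law M i = map_pmf (\<lambda>f. f(i := (undefined, 0))) (profile_law M)"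
    unfolding rivals_law_def profile_law_def by (rule Pi_pmf_remove) simp
  have sel: "1 - indicator {f. many f} f
      \<le> selection_prob ((means (f(i := (undefined, 0))))(i := y)) i" for f
  proof (cases "many f")
    case False
    let ?e = "(means (f(i := (undefined, 0))))(i := y)"
    have "card {j. j < N \<and> j \<noteq> i \<and> ?e i \<le> ?e j} \<le> card {j. j < N \<and> \<theta> \<le> means f j}"
      using \<theta> by (intro card_mono) (auto simp: means_def)
    then have "selection_prob ?e i = 1"
      using False i by (intro selection_prob_eq_1) (auto simp: many_def)
    then show ?thesis by simp
  qed (simp add: selection_prob_bounds)
  have "1 - SW M / (real k * \<theta>) \<le> measure_pmf.expectation (profile_law M) (\<lambda>f. 1 - indicator {f. many f} f)"
    using markov integrable_pmf_bounded[of "profile_law M" "indicat_real {f. many f}" 1]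
    by (subst Bochner_Integration.integral_diff) (auto simp: indicator_le_1)
  also have "\<dots> \<le> win_prob M i y"
    unfolding win_prob_def rivals integral_map_pmf using sel selection_prob_bounds
    by (intro expectation_mono_pmf[where A = 1 and B = 1]) (auto simp: indicator_def)
  finally show ?thesis .
qed

section \<open>Totals over all agents\<close>

lemma sum_expected_win_prob:
  "(\<Sum>i<N. measure_pmf.expectation (M i) (\<lambda>Z. measure_pmf.expectation (signal_law i Z)
     (\<lambda>s. win_prob M i (posterior_mean i Z s)))) = k"
proof -
  have "(\<Sum>i<N. measure_pmf.expectation (M i) (\<lambda>Z. measure_pmf.expectation (signal_law i Z)
     (\<lambda>s. win_prob M i (posterior_mean i Z s))))
    = (\<Sum>i<N. measure_pmf.expectation (profile_law M) (\<lambda>f. selection_prob (means f) i))"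
    using expectation_selection_prob[of _ M "\<lambda>_. 1" 1] by (intro sum.cong) (simp_all del: integral_map_pmf)
  also have "\<dots> = measure_pmf.expectation (profile_law M) (\<lambda>f. \<Sum>i<N. selection_prob (means f) i)"
    using selection_prob_bounds
    by (intro Bochner_Integration.integral_sum[symmetric] integrable_pmf_bounded[where B = 1]) auto
  finally show ?thesis by (simp add: sum_selection_prob_eq_k)
qed

text \<open>Each sum counts the posterior means of the agents selected, and no set of
  \<open>k\<close> agents exceeds the top \<open>k\<close> order statistics.\<close>

lemma sum_expected_win_value_le_SW:
  "(\<Sum>i<N. measure_pmf.expectation (M i) (\<lambda>Z. measure_pmf.expectation (signal_law i Z)
     (\<lambda>s. win_prob M i (posterior_mean i Z s) * posterior_mean i Z s))) \<le> SW M"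
proof -
  have bd: "\<bar>selection_prob (means f) i * means f i\<bar> \<le> 1"
    if "f \<in> set_pmf (profile_law M)" "i < N" for f i
    using selection_prob_bounds[of "means f" i] means_bounds[OF that]
    by (auto simp: abs_mult intro: mult_le_one)
  have bd': "\<bar>posterior_mean i (fst z) (snd z)\<bar> \<le> 1" if "z \<in> set_pmf (agent_law M i)" "i < N" for z i
    using that posterior_mean_bounds[of i "snd z" "fst z"]
      agent_law_support[of "fst z" "snd z" M i] by simp
  have "(\<Sum>i<N. measure_pmf.expectation (M i) (\<lambda>Z. measure_pmf.expectation (signal_law i Z)
     (\<lambda>s. win_prob M i (posterior_mean i Z s) * posterior_mean i Z s)))
    = (\<Sum>i<N. measure_pmf.expectation (profile_law M) (\<lambda>f. selection_prob (means f) i * means f i))"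
    using expectation_selection_prob[of _ M "\<lambda>z. posterior_mean _ (fst z) (snd z)" 1] bd'
    by (intro sum.cong) (simp_all add: means_def del: integral_map_pmf)
  also have "\<dots> = measure_pmf.expectation (profile_law M)
      (\<lambda>f. \<Sum>i<N. selection_prob (means f) i * means f i)"
    using bd
    by (intro Bochner_Integration.integral_sum[symmetric] integrable_pmf_bounded[where B = 1]) auto
  also have "\<dots> \<le> SW M"
    unfolding SW_eq
  proof (rule expectation_mono_pmf[where A = N and B = k])
    fix f assume f: "f \<in> set_pmf (profile_law M)"
    have "\<bar>\<Sum>i<N. selection_prob (means f) i * means f i\<bar> \<le> (\<Sum>i<N. 1)"
      using bd[OF f] by (intro order_trans[OF sum_abs] sum_mono) auto
    then show "\<bar>\<Sum>i<N. selection_prob (means f) i * means f i\<bar> \<le> N" by simp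
    show "\<bar>\<Sum>j<k. order_stat (means f) j\<bar> \<le> k"
      using sum_order_stat_bounds[of "means f"] means_bounds[OF f] by auto
    show "(\<Sum>i<N. selection_prob (means f) i * means f i) \<le> (\<Sum>j<k. order_stat (means f) j)"
      by (rule sum_selection_prob_means_le)
  qed
  finally show ?thesis .
qed

lemma SW_nonneg: "0 \<le> SW M"
  unfolding SW_eq using sum_order_stat_bounds means_bounds
  by (intro expectation_bounds_pmf(1)[where a = 0 and b = k]) auto

text \<open>Each of the \<open>k\<close> chosen values is at most \<theta> plus its excess over
  \<theta>. Counting the excess of all agents removes the maximum over sets.\<close>

lemma SW_max_le:
  assumes \<theta>: "0 \<le> \<theta>"
  shows "SW_max \<le> real k * \<theta> + (\<Sum>i<N. measure_pmf.expectation (F i) (\<lambda>v. max 0 (v - \<theta>)))"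
proof -
  let ?P = "Pi_pmf {..<N} 0 F"
  have supp: "v i \<in> V" if "v \<in> set_pmf ?P" "i < N" for v i
    using that prior_support[of i] by (auto simp: set_Pi_pmf PiE_dflt_def)
  have fin: "finite (set_pmf ?P)"
    using finite_subset[OF prior_support finite_V]
    by (auto simp: set_Pi_pmf)
  have int: "integrable (measure_pmf ?P) g" for g :: "_ \<Rightarrow> real"
    by (rule integrable_measure_pmf_finite[OF fin])
  have point: "(MAX S\<in>k_subsets. \<Sum>i\<in>S. v i) \<le> real k * \<theta> + (\<Sum>i<N. max 0 (v i - \<theta>))" for v :: "nat \<Rightarrow> real"
  proof (subst Max_le_iff)
    show "\<forall>a\<in>(\<lambda>S. \<Sum>i\<in>S. v i) ` k_subsets. a \<le> real k * \<theta> + (\<Sum>i<N. max 0 (v i - \<theta>))"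
    proof safe
      fix S assume S: "S \<in> k_subsets"
      then have SN: "S \<subseteq> {..<N}" "card S = k" by (auto simp: k_subsets_def)
      have "(\<Sum>i\<in>S. v i) \<le> (\<Sum>i\<in>S. \<theta> + max 0 (v i - \<theta>))" by (intro sum_mono) auto
      also have "\<dots> = real k * \<theta> + (\<Sum>i\<in>S. max 0 (v i - \<theta>))"
        using SN by (simp add: sum.distrib)
      also have "(\<Sum>i\<in>S. max 0 (v i - \<theta>)) \<le> (\<Sum>i<N. max 0 (v i - \<theta>))"
        using SN by (intro sum_mono2) auto
      finally show "(\<Sum>i\<in>S. v i) \<le> real k * \<theta> + (\<Sum>i<N. max 0 (v i - \<theta>))" by simp
    qed
  qed (use finite_k_subsets k_subsets_nonempty in auto)
  have "SW_max \<le> measure_pmf.expectation ?P (\<lambda>v. real k * \<theta> + (\<Sum>i<N. max 0 (v i - \<theta>)))"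
    unfolding SW_max_def using point by (intro integral_mono int)
  also have "\<dots> = real k * \<theta> + (\<Sum>i<N. measure_pmf.expectation ?P (\<lambda>v. max 0 (v i - \<theta>)))"
    by (simp add: int Bochner_Integration.integral_sum)
  also have "(\<Sum>i<N. measure_pmf.expectation ?P (\<lambda>v. max 0 (v i - \<theta>)))
      = (\<Sum>i<N. measure_pmf.expectation (map_pmf (\<lambda>v. v i) ?P) (\<lambda>v. max 0 (v - \<theta>)))" by simp
  also have "\<dots> = (\<Sum>i<N. measure_pmf.expectation (F i) (\<lambda>v. max 0 (v - \<theta>)))"
    by (intro sum.cong) (simp_all add: Pi_pmf_component del: integral_map_pmf)
  finally show ?thesis .
qed

section \<open>The pooling deviation\<close>

text \<open>A value has prior mass \<open>t i v * \<epsilon>\<close> and sends each signal with a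
  multiple of \<open>1 / t i v\<close>, so the joint masses are multiples of \<epsilon>. Atoms of
  size at least \<open>1 / t i v\<close> are finitely many, which makes the sum over
  \<open>A\<close> finite.\<close>

lemma pure_strategy_mass_units:
  assumes i: "i < N" and Z: "Z \<in> pure_strategies i" and v: "v \<in> V"
  obtains b :: nat where "pmf (F i) v * measure_pmf.prob (kernel Z v) A = real b * \<epsilon>"
proof (cases "t i v \<ge> 1")
  case False
  \<comment> \<open>The kernel is unconstrained at a value with \<open>t i v = 0\<close>, but there
    the prior mass is zero.\<close>
  then show thesis using prior_mass[OF i v] by (intro that[of 0]) simp
next
  case True
  let ?K = "kernel Z v"
  have "\<exists>m::int. pmf ?K s = of_int m * (1 / real (t i v))" for s
  proof (cases "s \<in> signals Z")
    case False
    then have "pmf ?K s = 0"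
      using Z v by (auto simp: pure_strategies_def pmf_eq_0_set_pmf)
    then show ?thesis by (intro exI[of _ 0]) simp
  qed (use Z v True in \<open>auto simp: pure_strategies_def\<close>)
  then obtain m :: "nat \<Rightarrow> int" where m: "\<And>s. pmf ?K s = of_int (m s) * (1 / real (t i v))"
    by metis
  have m_nonneg: "0 \<le> m s" for s
    using m[of s] pmf_nonneg[of ?K s] True by (simp add: zero_le_divide_iff)
  have "1 / real (t i v) \<le> pmf ?K s" if "s \<in> set_pmf ?K" for s
  proof -
    have "m s \<noteq> 0" using that m[of s] by (auto simp: set_pmf_iff)
    then have "1 \<le> m s" using m_nonneg[of s] by linarith
    then have "1 * (1 / real (t i v)) \<le> of_int (m s) * (1 / real (t i v))"
      by (intro mult_right_mono) auto
    then show ?thesis using m[of s] by simp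
  qed
  then have fin: "finite (set_pmf ?K)" using True by (intro finite_set_pmf_ge[of "1 / real (t i v)"]) auto
  have "measure_pmf.prob ?K A = (\<Sum>s\<in>A \<inter> set_pmf ?K. pmf ?K s)"
    using fin measure_measure_pmf_finite[of "A \<inter> set_pmf ?K" ?K] by (simp add: measure_Int_set_pmf)
  also have "\<dots> = of_int (\<Sum>s\<in>A \<inter> set_pmf ?K. m s) * (1 / real (t i v))"
    unfolding m by (simp add: sum_divide_distrib)
  finally have "pmf (F i) v * measure_pmf.prob ?K A = of_int (\<Sum>s\<in>A \<inter> set_pmf ?K. m s) * \<epsilon>"
    using True by (simp add: prior_mass[OF i v])
  also have "of_int (\<Sum>s\<in>A \<inter> set_pmf ?K. m s) = real (nat (\<Sum>s\<in>A \<inter> set_pmf ?K. m s))"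
    using m_nonneg by (simp add: sum_nonneg)
  finally show thesis by (rule that)
qed

section \<open>Joint masses of values and signals\<close>

text \<open>The joint expectation of \<open>\<phi> s * w v\<close> is computed twice: signal first
  through the posteriors, and value first through the kernel.\<close>

lemma expectation_signal_law:
  fixes \<phi> :: "nat \<Rightarrow> real" and w :: "real \<Rightarrow> real"
  assumes i: "i < N" and \<phi>: "\<And>s. \<bar>\<phi> s\<bar> \<le> B"
  shows "measure_pmf.expectation (signal_law i Z) (\<lambda>s. \<phi> s * measure_pmf.expectation (posterior i Z s) w)
       = (\<Sum>v\<in>V. pmf (F i) v * w v * measure_pmf.expectation (kernel Z v) \<phi>)"
proof -
  define C where "C = (\<Sum>v\<in>V. \<bar>w v\<bar>)"
  have w: "\<bar>w v\<bar> \<le> C" if "v \<in> V" for v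
    unfolding C_def using member_le_sum[OF that, of "\<lambda>v. \<bar>w v\<bar>"] finite_V by simp
  have "\<bar>\<phi> s * w v\<bar> \<le> B * C" if "v \<in> V" for v s
    using \<phi> w[OF that] unfolding abs_mult by (meson abs_ge_zero mult_mono order_trans)
  then have "measure_pmf.expectation (value_signal i Z) (\<lambda>x. \<phi> (snd x) * w (fst x))
      = (\<Sum>v\<in>V. pmf (F i) v * measure_pmf.expectation (kernel Z v) (\<lambda>s. \<phi> s * w v))"
    by (rule expectation_value_signal[OF i])
  moreover have "measure_pmf.expectation (value_signal i Z) (\<lambda>x. \<phi> (snd x) * w (fst x))
      = measure_pmf.expectation (signal_law i Z)
          (\<lambda>s. \<phi> s * measure_pmf.expectation (posterior i Z s) w)"
    by (rule expectation_posterior[OF i \<phi>]) (rule w)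
  ultimately show ?thesis by (simp add: mult_ac del: integral_map_pmf)
qed

lemma signal_mass:
  assumes i: "i < N"
  shows "pmf (signal_law i Z) s = (\<Sum>v\<in>V. pmf (F i) v * pmf (kernel Z v) s)"
  using expectation_signal_law[OF i, of "indicat_real {s}" 1 Z "\<lambda>_. 1"]
  by (simp add: measure_pmf_single del: integral_map_pmf measure_map_pmf)

text \<open>Bayes' rule with the denominator multiplied out, so that it also holds for signals of
  mass zero.\<close>

lemma signal_mass_posterior_mean:
  assumes i: "i < N"
  shows "(\<Sum>v\<in>V. pmf (F i) v * pmf (kernel Z v) s * v)
       = (\<Sum>v\<in>V. pmf (F i) v * pmf (kernel Z v) s) * posterior_mean i Z s"
proof -
  have "measure_pmf.expectation (signal_law i Z) (\<lambda>x. indicator {s} x * posterior_mean i Z x)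
      = measure_pmf.expectation (signal_law i Z) (\<lambda>x. indicator {s} x * posterior_mean i Z s)"
    by (intro expectation_cong_pmf) (auto simp: indicator_def)
  also have "\<dots> = pmf (signal_law i Z) s * posterior_mean i Z s"
    by (simp add: measure_pmf_single del: integral_map_pmf measure_map_pmf)
  finally show ?thesis
    using expectation_signal_law[OF i, of "indicat_real {s}" 1 Z "\<lambda>v. v"]
    by (simp add: signal_mass[OF i] posterior_mean_def measure_pmf_single mult.assoc
          mult.commute[of "pmf (kernel _ _) _"] del: integral_map_pmf)
qed

text \<open>The pooled fraction \<open>r v\<close> depends on the value. Taking \<open>UNIV\<close>
  as label set is consistent with discretization, since labels never sent have probability 0, a
  multiple of \<open>1 / t i v\<close>.\<close>

definition pool :: "nat set \<Rightarrow> (real \<Rightarrow> real) \<Rightarrow> scheme \<Rightarrow> scheme" where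
  "pool B r Z = \<lparr>signals = UNIV, kernel = \<lambda>v. pool_kernel B (r v) (kernel Z v)\<rparr>"

text \<open>Of the \<open>t i v\<close> units at \<open>v\<close>, exactly \<open>b v\<close> go to
  \<open>B\<close>; the pool takes \<open>c v\<close>, label 1 takes \<open>b v - c v\<close>, and
  the other signals keep theirs.\<close>

lemma pool_pure:
  fixes b c :: "real \<Rightarrow> nat"
  assumes i: "i < N" and Z: "Z \<in> pure_strategies i"
    and b: "\<And>v. v \<in> V \<Longrightarrow> pmf (F i) v * measure_pmf.prob (kernel Z v) B = real (b v) * \<epsilon>"
    and c: "\<And>v. v \<in> V \<Longrightarrow> c v \<le> b v"
  shows "pool B (\<lambda>v. real (c v) / real (b v)) Z \<in> pure_strategies i"
proof -
  have "\<exists>m::int. pmf (pool_kernel B (real (c v) / real (b v)) (kernel Z v)) s = of_int m * (1 / real (t i v))"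
    if v: "v \<in> V" and t: "1 \<le> t i v" for v s
  proof -
    let ?r = "real (c v) / real (b v)"
    \<comment> \<open>For \<open>b v = 0\<close> the quotient is 0 by the convention for
      division.\<close>
    have r: "0 \<le> ?r" "?r \<le> 1" using c[OF v] by (auto simp: divide_le_eq_1)
    have prob: "measure_pmf.prob (kernel Z v) B = real (b v) / real (t i v)"
      using b[OF v] prior_mass[OF i v] t eps_pos by (simp add: field_simps)
    consider "s = 0" | "s = 1" | s' where "s = s' + 2"
      by (metis One_nat_def add_2_eq_Suc' not0_implies_Suc)
    then show ?thesis
    proof cases
      case 1
      then have "pmf (pool_kernel B ?r (kernel Z v)) s = of_int (int (c v)) * (1 / real (t i v))"
        using c[OF v] by (simp add: pmf_pool_kernel(1)[OF r] prob)
      then show ?thesis by blast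
    next
      case 2
      then have "pmf (pool_kernel B ?r (kernel Z v)) s = of_int (int (b v - c v)) * (1 / real (t i v))"
        using c[OF v] by (simp only: 2 pmf_pool_kernel(2)[OF r] prob) (simp add: field_simps of_nat_diff)
      then show ?thesis by blast
    next
      case 3
      show ?thesis
      proof (cases "s' \<in> B \<or> s' \<notin> signals Z")
        case True
        then have "pmf (pool_kernel B ?r (kernel Z v)) s = of_int 0 * (1 / real (t i v))"
          using Z v by (auto simp only: 3 pmf_pool_kernel(3)[OF r])
            (auto simp: pure_strategies_def pmf_eq_0_set_pmf)
        then show ?thesis by blast
      next
        case False
        then show ?thesis
          using Z v t by (simp only: 3 pmf_pool_kernel(3)[OF r]) (auto simp: pure_strategies_def)
      qed
    qed
  qed
  then show ?thesis by (auto simp: pure_strategies_def pool_def)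
qed

lemma expectation_prior:
  assumes "i < N"
  shows "measure_pmf.expectation (F i) g = (\<Sum>v\<in>V. pmf (F i) v * g v :: real)"
  using prior_support[OF assms] finite_V by (subst integral_measure_pmf[of V]) auto

text \<open>The label \<open>s + 2\<close> inherits the joint masses of \<open>s\<close> at all
  values. As \<open>s\<close> has positive mass, Bayes' rule can be divided by it.\<close>

lemma pool_signal_mean:
  assumes i: "i < N" and r: "\<And>v. v \<in> V \<Longrightarrow> 0 \<le> r v" "\<And>v. v \<in> V \<Longrightarrow> r v \<le> 1" and s: "s \<notin> B"
    and v: "v \<in> V" "pmf (F i) v \<noteq> 0" "s \<in> set_pmf (kernel Z v)"
  shows "posterior_mean i (pool B r Z) (s + 2) = posterior_mean i Z s"
proof -
  have "(\<Sum>v\<in>V. pmf (F i) v * pmf (kernel Z v) s) \<noteq> 0"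
    using v finite_V by (subst sum_nonneg_eq_0_iff) (auto simp: set_pmf_iff)
  moreover have "pmf (kernel (pool B r Z) v) (s + 2) = pmf (kernel Z v) s" if "v \<in> V" for v
    unfolding pool_def using pmf_pool_kernel(3)[OF r(1)[OF that] r(2)[OF that], of B "kernel Z v" s] s by simp
  ultimately show ?thesis
    using signal_mass_posterior_mean[OF i, of Z s] signal_mass_posterior_mean[OF i, of "pool B r Z" "s + 2"]
    by simp
qed

text \<open>The joint mass of \<open>v\<close> and label 0 is \<open>m v\<close>. By Bayes' rule the
  surplus in \<open>mean\<close> is the mass of the pool times its mean minus \<theta>, and that
  mass is positive.\<close>

lemma pooled_mean_ge:
  assumes i: "i < N" and r: "\<And>v. v \<in> V \<Longrightarrow> 0 \<le> r v" "\<And>v. v \<in> V \<Longrightarrow> r v \<le> 1"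
    and m: "\<And>v. v \<in> V \<Longrightarrow> pmf (F i) v * (r v * measure_pmf.prob (kernel Z v) B) = m v"
    and mean: "0 \<le> (\<Sum>v\<in>V. m v * (v - \<theta>))" and v: "v \<in> V" "m v \<noteq> 0"
  shows "\<theta> \<le> posterior_mean i (pool B r Z) 0"
proof -
  have k0: "pmf (F i) v * pmf (kernel (pool B r Z) v) 0 = m v" if "v \<in> V" for v
    using m[OF that] pmf_pool_kernel(1)[OF r(1)[OF that] r(2)[OF that], of B "kernel Z v"] by (simp add: pool_def)
  have nonneg: "0 \<le> m v" if "v \<in> V" for v using k0[OF that] by (metis mult_nonneg_nonneg pmf_nonneg)
  have "(\<Sum>v\<in>V. m v * v) = (\<Sum>v\<in>V. m v) * posterior_mean i (pool B r Z) 0"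
    using signal_mass_posterior_mean[OF i, of "pool B r Z" 0] k0
    by simp
  then have "0 \<le> (\<Sum>v\<in>V. m v) * (posterior_mean i (pool B r Z) 0 - \<theta>)"
    using mean by (simp add: right_diff_distrib sum_subtractf sum_distrib_right)
  moreover have "0 < (\<Sum>v\<in>V. m v)"
    using v nonneg finite_V by (intro sum_pos2[of V v]) (auto simp: less_le)
  ultimately show ?thesis by (simp add: zero_le_mult_iff)
qed

section \<open>The bound for a single agent\<close>

text \<open>The three terms pay, in this order, for high values sent with good signals, for the mass
  that could be pooled, and for rounding the pool to units of \<epsilon>.\<close>

lemma excess_value_bound:
  assumes eq: "nash_equilibrium M" and i: "i < N" and Z: "Z \<in> set_pmf (M i)" and \<theta>: "0 < \<theta>"
    and win: "\<And>y. \<theta> \<le> y \<Longrightarrow> 2 / 3 \<le> win_prob M i y"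
  shows "measure_pmf.expectation (F i) (\<lambda>v. max 0 (v - \<theta>))
     \<le> 3 * measure_pmf.expectation (signal_law i Z)
              (\<lambda>s. win_prob M i (posterior_mean i Z s) * posterior_mean i Z s)
       + 3 * \<theta> * measure_pmf.expectation (signal_law i Z) (\<lambda>s. win_prob M i (posterior_mean i Z s))
       + \<theta> * \<epsilon>"
proof -
  define h where "h s = win_prob M i (posterior_mean i Z s)" for s
  \<comment> \<open>The bad signals. The bound \<open>1 / 3\<close> is half of the
    \<open>2 / 3\<close> guaranteed to a pool, so fully pooled values gain at least a third of their
    mass.\<close>
  define B where "B = {s. h s < 1 / 3}"
  define p where "p v = pmf (F i) v" for v
  have h: "0 \<le> h s" "h s \<le> 1" for s by (auto simp: h_def win_prob_bounds)
  have h_abs: "\<bar>h s\<bar> \<le> 1" for s using h[of s] by simp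
  have hB_abs: "\<bar>h s * indicator B s\<bar> \<le> 1" for s using h_abs by (simp add: indicator_def)
  have p0: "0 \<le> p v" for v by (simp add: p_def)
  have V0: "0 \<le> v" "v \<le> 1" if "v \<in> V" for v using that V_unit by auto
  have V_nonneg: "V \<subseteq> {0..}" using V0 by auto
  have V_ne: "V \<noteq> {}" using prior_support[OF i] set_pmf_not_empty[of "F i"] by blast
  have pureZ: "Z \<in> pure_strategies i"
    using eq i Z by (auto simp: nash_equilibrium_def mixed_profile_def)
  have int: "integrable (measure_pmf (kernel Z v)) g" if "\<And>s. \<bar>g s\<bar> \<le> 1" for v and g :: "nat \<Rightarrow> real"
    using that by (intro integrable_pmf_bounded[where B = 1]) auto
  have "\<forall>v. \<exists>b::nat. v \<in> V \<longrightarrow> p v * measure_pmf.prob (kernel Z v) B = real b * \<epsilon>"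
    unfolding p_def using pure_strategy_mass_units[OF i pureZ] by metis
  then obtain b :: "real \<Rightarrow> nat"
    where b: "\<And>v. v \<in> V \<Longrightarrow> p v * measure_pmf.prob (kernel Z v) B = real (b v) * \<epsilon>" by metis

  \<comment> \<open>A signal of mean at least \<theta> wins with probability \<open>2 / 3\<close>
    and is not bad. Hence bad signals have means below \<theta>, and so does their union.\<close>
  have low_mean: "(\<Sum>v\<in>V. real (b v) * (v - \<theta>)) \<le> 0"
  proof -
    have "\<epsilon> * (\<Sum>v\<in>V. real (b v) * (v - \<theta>))
        = (\<Sum>v\<in>V. p v * (v - \<theta>) * measure_pmf.expectation (kernel Z v) (indicator B))"
      using b by (simp add: sum_distrib_left algebra_simps)
    also have "\<dots> = measure_pmf.expectation (signal_law i Z)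
        (\<lambda>s. indicator B s * measure_pmf.expectation (posterior i Z s) (\<lambda>v. v - \<theta>))"
      unfolding p_def by (rule expectation_signal_law[OF i, where B = 1, symmetric]) auto
    also have "\<dots> \<le> 0"
    proof (rule expectation_bounds_pmf(2)[where a = "- (1 + \<theta>)"])
      fix s assume s: "s \<in> set_pmf (signal_law i Z)"
      have "finite (set_pmf (posterior i Z s))"
        using finite_subset[OF posterior_support[OF i s] finite_V] .
      then have e: "measure_pmf.expectation (posterior i Z s) (\<lambda>v. v - \<theta>) = posterior_mean i Z s - \<theta>"
        by (simp add: posterior_mean_def integrable_measure_pmf_finite)
      have "posterior_mean i Z s < \<theta>" if "s \<in> B"
        using that win[of "posterior_mean i Z s"] by (force simp: B_def h_def)
      then show "indicator B s * measure_pmf.expectation (posterior i Z s) (\<lambda>v. v - \<theta>) \<le> 0"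
        unfolding e by (auto simp: indicator_def)
      show "- (1 + \<theta>) \<le> indicator B s * measure_pmf.expectation (posterior i Z s) (\<lambda>v. v - \<theta>)"
        unfolding e using posterior_mean_bounds[OF i s] \<theta> by (auto simp: indicator_def)
    qed
    finally show ?thesis using eps_pos by (simp add: mult_le_0_iff)
  qed
  obtain v0 :: real and c :: "real \<Rightarrow> nat" where v0: "v0 \<in> V"
    and c_top: "\<forall>v\<in>V. c v \<le> b v \<and> (v0 < v \<longrightarrow> c v = b v) \<and> (v < v0 \<longrightarrow> c v = 0)"
    and c_mean: "0 \<le> (\<Sum>v\<in>V. real (c v) * (v - \<theta>))"
    and c_max: "(\<Sum>v\<in>V. real (b v) * max 0 (v - \<theta>)) \<le> \<theta> * ((\<Sum>v\<in>V. real (c v)) + 1)"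
    by (rule greedy_pool_exists[OF finite_V V_ne V_nonneg \<theta> low_mean])
  have c: "c v \<le> b v" "v0 < v \<Longrightarrow> c v = b v" "v < v0 \<Longrightarrow> c v = 0" if "v \<in> V" for v
    using c_top that by auto

  have "(\<Sum>v\<in>V. real (c v) * \<epsilon> * (v - \<theta>)) = \<epsilon> * (\<Sum>v\<in>V. real (c v) * (v - \<theta>))"
    by (simp add: sum_distrib_left mult_ac)
  then have c_mean_eps: "0 \<le> (\<Sum>v\<in>V. real (c v) * \<epsilon> * (v - \<theta>))"
    using c_mean eps_pos by simp

  define r where "r v = real (c v) / real (b v)" for v
  have r: "0 \<le> r v" "r v \<le> 1" if "v \<in> V" for v
    using c(1)[OF that] by (auto simp: r_def divide_le_eq_1)
  have pr: "p v * (r v * measure_pmf.prob (kernel Z v) B) = real (c v) * \<epsilon>" if "v \<in> V" for v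
  proof -
    have "p v * (r v * measure_pmf.prob (kernel Z v) B) = r v * (real (b v) * \<epsilon>)"
      using b[OF that] by (simp add: algebra_simps)
    also have "\<dots> = real (c v) * \<epsilon>" using c(1)[OF that] by (simp add: r_def)
    finally show ?thesis .
  qed
  let ?Z = "pool B r Z"
  define h' where "h' s = win_prob M i (posterior_mean i ?Z s)" for s
  have h': "0 \<le> h' s" "h' s \<le> 1" for s by (auto simp: h'_def win_prob_bounds)
  have h'_abs: "\<bar>h' s\<bar> \<le> 1" for s using h'[of s] by simp
  \<comment> \<open>\<open>H v\<close> is the probability that the value is \<open>v\<close> and
    agent \<open>i\<close> is selected with a bad signal.\<close>
  define H where "H v = p v * measure_pmf.expectation (kernel Z v) (\<lambda>s. h s * indicator B s)" for v
  have payoffs: "scheme_payoff M i Y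
      = (\<Sum>v\<in>V. p v * u i v * measure_pmf.expectation (kernel Y v) (\<lambda>s. win_prob M i (posterior_mean i Y s)))" for Y
    unfolding scheme_payoff_def posterior_utility_def p_def
    by (rule expectation_signal_law[OF i, where B = 1]) (simp add: win_prob_bounds)

  \<comment> \<open>Pooling forfeits the wins \<open>H v\<close> and earns at least
    \<open>2 / 3\<close> of the pooled mass. Label 1 is credited with nothing, and the other signals
    win as before.\<close>
  have gain_v: "p v * measure_pmf.expectation (kernel Z v) h - H v + 2 / 3 * (real (c v) * \<epsilon>)
      \<le> p v * measure_pmf.expectation (kernel ?Z v) h'" if v: "v \<in> V" for v
  proof (cases "p v = 0")
    case True
    then show ?thesis using pr[OF v] eps_pos by (auto simp: H_def)
  next
    case False
    \<comment> \<open>The mean of label 0 is controlled only when the label has positive mass, hence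
      the case split on \<open>r v\<close>.\<close>
    have "2 / 3 * r v \<le> r v * h' 0 + (1 - r v) * h' 1" if "measure_pmf.prob (kernel Z v) B \<noteq> 0"
    proof (cases "r v = 0")
      case False
      then have "real (c v) * \<epsilon> \<noteq> 0"
        unfolding pr[OF v, symmetric] using \<open>p v \<noteq> 0\<close> that by simp
      then have "\<theta> \<le> posterior_mean i ?Z 0"
        using pr by (intro pooled_mean_ge[OF i r _ c_mean_eps v]) (simp_all add: p_def)
      then have "2 / 3 \<le> h' 0" using win by (simp add: h'_def)
      then have "r v * (2 / 3) \<le> r v * h' 0" using r[OF v] by (intro mult_left_mono)
      moreover have "0 \<le> (1 - r v) * h' 1" using r[OF v] h'[of 1] by simp
      ultimately show ?thesis by linarith
    qed (use h'[of 1] in simp)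
    moreover have "measure_pmf.prob (kernel Z v) B \<noteq> 0" if "s \<in> set_pmf (kernel Z v)" "s \<in> B" for s
      using measure_pmf_posI[OF that] by simp
    moreover have "h' (s + 2) = h s" if "s \<in> set_pmf (kernel Z v)" "s \<notin> B" for s
      using pool_signal_mean[OF i r that(2) v _ that(1)] False by (simp add: h'_def h_def p_def)
    ultimately have point: "h s - h s * indicator B s + 2 / 3 * r v * indicator B s
        \<le> (if s \<in> B then r v * h' 0 + (1 - r v) * h' 1 else h' (s + 2))"
      if "s \<in> set_pmf (kernel Z v)" for s
      using that by (auto simp: indicator_def)
    have conv: "\<bar>r v * h' 0 + (1 - r v) * h' 1\<bar> \<le> 1"
    proof -
      have "r v * h' 0 + (1 - r v) * h' 1 \<le> r v * 1 + (1 - r v) * 1"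
        using r[OF v] h' by (intro add_mono mult_left_mono) auto
      moreover have "0 \<le> r v * h' 0 + (1 - r v) * h' 1" using r[OF v] h' by simp
      ultimately show ?thesis by simp
    qed
    have "measure_pmf.expectation (kernel Z v) h - measure_pmf.expectation (kernel Z v) (\<lambda>s. h s * indicator B s)
        + 2 / 3 * r v * measure_pmf.prob (kernel Z v) B
      = measure_pmf.expectation (kernel Z v) (\<lambda>s. h s - h s * indicator B s + 2 / 3 * r v * indicator B s)"
      using h_abs hB_abs by (simp add: int)
    also have "\<dots> \<le> measure_pmf.expectation (kernel Z v)
        (\<lambda>s. if s \<in> B then r v * h' 0 + (1 - r v) * h' 1 else h' (s + 2))"
    proof (rule expectation_mono_pmf[where A = 1 and B = 1])
      show "\<bar>h s - h s * indicator B s + 2 / 3 * r v * indicator B s\<bar> \<le> 1" for s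
        using h[of s] r[OF v] by (auto simp: indicator_def)
    qed (use point conv h'_abs in auto)
    also have "\<dots> = measure_pmf.expectation (kernel ?Z v) h'"
      unfolding pool_def using expectation_pool_kernel[OF r[OF v], of h' 1 B "kernel Z v"] h'_abs by simp
    finally have "p v * (measure_pmf.expectation (kernel Z v) h
        - measure_pmf.expectation (kernel Z v) (\<lambda>s. h s * indicator B s)
        + 2 / 3 * r v * measure_pmf.prob (kernel Z v) B) \<le> p v * measure_pmf.expectation (kernel ?Z v) h'"
      using p0 by (rule mult_left_mono)
    then show ?thesis using pr[OF v] by (simp add: H_def algebra_simps)
  qed
  have "scheme_payoff M i ?Z \<le> scheme_payoff M i Z"
    unfolding r_def using b c(1)
    by (intro equilibrium_best_response[OF eq i Z] pool_pure[OF i pureZ]) (auto simp: p_def)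
  then have best: "(\<Sum>v\<in>V. p v * u i v * measure_pmf.expectation (kernel ?Z v) h')
      \<le> (\<Sum>v\<in>V. p v * u i v * measure_pmf.expectation (kernel Z v) h)"
    unfolding payoffs h_def[abs_def] h'_def[abs_def] .
  have "(\<Sum>v\<in>V. u i v * (p v * measure_pmf.expectation (kernel Z v) h - H v + 2 / 3 * (real (c v) * \<epsilon>)))
      \<le> (\<Sum>v\<in>V. u i v * (p v * measure_pmf.expectation (kernel ?Z v) h'))"
    using gain_v u_bounds(1)[OF i] by (intro sum_mono mult_left_mono) auto
  also have "\<dots> \<le> (\<Sum>v\<in>V. u i v * (p v * measure_pmf.expectation (kernel Z v) h))"
    using best by (simp add: mult_ac)
  finally have gain: "0 \<le> (\<Sum>v\<in>V. u i v * (H v - 2 / 3 * (real (c v) * \<epsilon>)))"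
    by (simp add: algebra_simps sum.distrib sum_subtractf)

  have H: "0 \<le> H v" "H v \<le> real (b v) * \<epsilon> / 3" if v: "v \<in> V" for v
  proof -
    show "0 \<le> H v" unfolding H_def using h p0 by (intro mult_nonneg_nonneg integral_nonneg) auto
    have "measure_pmf.expectation (kernel Z v) (\<lambda>s. h s * indicator B s)
        \<le> measure_pmf.expectation (kernel Z v) (\<lambda>s. 1 / 3 * indicator B s)"
      using h by (intro expectation_mono_pmf[where A = 1 and B = 1]) (auto simp: indicator_def B_def)
    then have "H v \<le> p v * (1 / 3 * measure_pmf.prob (kernel Z v) B)"
      unfolding H_def using p0 by (intro mult_left_mono) auto
    then show "H v \<le> real (b v) * \<epsilon> / 3" using b[OF v] by simp
  qed
  have pooled: "(\<Sum>v\<in>V. real (c v) * \<epsilon>) \<le> 3 * (\<Sum>v\<in>V. H v)"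
  proof (rule pooled_mass_bound[where u = "u i" and b = "\<lambda>v. real (b v) * \<epsilon>" and \<theta> = \<theta> and ?v0.0 = v0])
    show "u i v \<le> u i w" if "v \<in> V" "w \<in> V" "v \<le> w" for v w
      using monotone_onD[OF u_mono[OF i], of v w] that V0 by auto
    show "0 < u i v" if "v \<in> V" "0 < v" for v using u_pos[OF i, of v] that V0 by auto
  qed (use finite_V V_nonneg v0 c_mean_eps \<theta> u_bounds(1)[OF i] c eps_pos H gain in auto)

  have split: "p v = real (b v) * \<epsilon> + p v * measure_pmf.prob (kernel Z v) (- B)" if "v \<in> V" for v
    using measure_pmf.prob_compl[of B "kernel Z v"]
    by (simp add: b[OF that, symmetric] Compl_eq_Diff_UNIV right_diff_distrib)
  \<comment> \<open>Off \<open>B\<close> the winning probability is at least \<open>1 / 3\<close>,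
    so the indicator is at most \<open>3 * h\<close>.\<close>
  have good: "measure_pmf.prob (kernel Z v) (- B) \<le> 3 * measure_pmf.expectation (kernel Z v) h" for v
  proof -
    have "measure_pmf.expectation (kernel Z v) (indicator (- B)) \<le> measure_pmf.expectation (kernel Z v) (\<lambda>s. 3 * h s)"
      using h by (intro expectation_mono_pmf[where A = 1 and B = 3]) (auto simp: indicator_def B_def not_less)
    then show ?thesis by simp
  qed
  have "measure_pmf.expectation (F i) (\<lambda>v. max 0 (v - \<theta>)) = (\<Sum>v\<in>V. p v * max 0 (v - \<theta>))"
    unfolding p_def by (rule expectation_prior[OF i])
  also have "\<dots> \<le> (\<Sum>v\<in>V. \<epsilon> * (real (b v) * max 0 (v - \<theta>)) + 3 * (p v * v * measure_pmf.expectation (kernel Z v) h))"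
  proof (rule sum_mono)
    fix v assume v: "v \<in> V"
    have "p v * max 0 (v - \<theta>) = \<epsilon> * (real (b v) * max 0 (v - \<theta>))
        + p v * measure_pmf.prob (kernel Z v) (- B) * max 0 (v - \<theta>)"
      by (subst split[OF v]) (simp add: algebra_simps)
    \<comment> \<open>The excess is enlarged to \<open>v\<close> itself, so that the sum becomes a
      winning-weighted posterior mean, which welfare bounds.\<close>
    also have "p v * measure_pmf.prob (kernel Z v) (- B) * max 0 (v - \<theta>)
        \<le> p v * (3 * measure_pmf.expectation (kernel Z v) h) * v"
      using good[of v] p0[of v] V0[OF v] \<theta> h
      by (intro mult_mono mult_left_mono mult_nonneg_nonneg) (auto intro: integral_nonneg)
    finally show "p v * max 0 (v - \<theta>) \<le> \<epsilon> * (real (b v) * max 0 (v - \<theta>))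
        + 3 * (p v * v * measure_pmf.expectation (kernel Z v) h)" by (simp add: mult_ac)
  qed
  also have "\<dots> = \<epsilon> * (\<Sum>v\<in>V. real (b v) * max 0 (v - \<theta>))
      + 3 * (\<Sum>v\<in>V. p v * v * measure_pmf.expectation (kernel Z v) h)"
    by (simp add: sum.distrib sum_distrib_left)
  also have "(\<Sum>v\<in>V. p v * v * measure_pmf.expectation (kernel Z v) h)
      = measure_pmf.expectation (signal_law i Z) (\<lambda>s. h s * posterior_mean i Z s)"
    unfolding p_def posterior_mean_def[of i Z]
    by (rule expectation_signal_law[OF i h_abs, symmetric])
  also have "\<epsilon> * (\<Sum>v\<in>V. real (b v) * max 0 (v - \<theta>)) \<le> \<epsilon> * (\<theta> * ((\<Sum>v\<in>V. real (c v)) + 1))"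
    using c_max eps_pos by (intro mult_left_mono) auto
  also have "\<epsilon> * (\<theta> * ((\<Sum>v\<in>V. real (c v)) + 1)) = \<theta> * (\<Sum>v\<in>V. real (c v) * \<epsilon>) + \<theta> * \<epsilon>"
    by (simp add: sum_distrib_left algebra_simps)
  also have "(\<Sum>v\<in>V. real (c v) * \<epsilon>) \<le> 3 * measure_pmf.expectation (signal_law i Z) h"
  proof -
    have "H v \<le> p v * measure_pmf.expectation (kernel Z v) h" for v
      unfolding H_def using h p0
      by (intro mult_left_mono expectation_mono_pmf[where A = 1 and B = 1]) (auto simp: indicator_def)
    then have "(\<Sum>v\<in>V. H v) \<le> (\<Sum>v\<in>V. p v * measure_pmf.expectation (kernel Z v) h)" by (rule sum_mono)
    also have "\<dots> = measure_pmf.expectation (signal_law i Z) h"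
      using expectation_signal_law[where \<phi> = h and w = "\<lambda>_. 1" and Z = Z, OF i h_abs] by (simp add: p_def del: integral_map_pmf)
    finally show ?thesis using pooled by linarith
  qed
  finally show ?thesis
    using \<theta> by (simp add: h_def[abs_def] algebra_simps del: integral_map_pmf)
qed

section \<open>The welfare bound at equilibrium\<close>

text \<open>A positive upper bound \<open>x\<close> replaces \<open>SW M\<close> to keep \<theta>
  positive when welfare is zero. The 15 is 3 from \<open>real k * \<theta>\<close>, 3 from good
  signals and 9 from \<open>3 * \<theta> * k\<close>; the rounding gives
  \<open>3 * \<epsilon> * N\<close>.\<close>

lemma SW_max_le_equilibrium_bound:
  assumes eq: "nash_equilibrium M" and x: "0 < x" "SW M \<le> x"
  shows "SW_max \<le> (15 + 3 * (\<epsilon> * real N)) * x"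
proof -
  \<comment> \<open>With this choice Markov's inequality fails with probability at most
    \<open>1 / 3\<close>.\<close>
  define \<theta> where "\<theta> = 3 * x / real k"
  have k: "1 \<le> real k" using k_ge_1 by simp
  have \<theta>: "0 < \<theta>" and k\<theta>: "real k * \<theta> = 3 * x" using x k by (auto simp: \<theta>_def)
  have \<theta>_le: "\<theta> \<le> 3 * x" using x k by (simp add: \<theta>_def divide_le_eq)
  define A where "A i Z = measure_pmf.expectation (signal_law i Z)
      (\<lambda>s. win_prob M i (posterior_mean i Z s) * posterior_mean i Z s)" for i Z
  define P where "P i Z = measure_pmf.expectation (signal_law i Z)
      (\<lambda>s. win_prob M i (posterior_mean i Z s))" for i Z
  have win: "2 / 3 \<le> win_prob M i y" if "i < N" "\<theta> \<le> y" for i y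
  proof -
    have "SW M / (real k * \<theta>) \<le> 1 / 3" using x by (simp add: k\<theta>)
    then show ?thesis using win_prob_ge[OF that(1) \<theta> that(2), of M] by linarith
  qed
  have agent: "measure_pmf.expectation (F i) (\<lambda>v. max 0 (v - \<theta>))
      \<le> 3 * measure_pmf.expectation (M i) (A i) + 3 * \<theta> * measure_pmf.expectation (M i) (P i) + \<theta> * \<epsilon>"
    if i: "i < N" for i
  proof -
    have "0 \<le> win_prob M i (posterior_mean i Z s) * posterior_mean i Z s"
      "win_prob M i (posterior_mean i Z s) * posterior_mean i Z s \<le> 1"
      if "s \<in> set_pmf (signal_law i Z)" for Z s
      using win_prob_bounds[of M i] posterior_mean_bounds[OF i that] by (simp_all add: mult_le_one)
    then have A: "0 \<le> A i Z" "A i Z \<le> 1" for Z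
      unfolding A_def by (intro expectation_bounds_pmf[where a = 0 and b = 1]; blast)+
    have P: "0 \<le> P i Z" "P i Z \<le> 1" for Z
      unfolding P_def by (intro expectation_bounds_pmf[where a = 0 and b = 1] win_prob_bounds)+
    have int: "integrable (measure_pmf (M i)) (A i)" "integrable (measure_pmf (M i)) (P i)"
      using A P by (auto intro!: integrable_pmf_bounded[where B = 1])
    have "measure_pmf.expectation (F i) (\<lambda>v. max 0 (v - \<theta>))
        \<le> measure_pmf.expectation (M i) (\<lambda>Z. 3 * A i Z + 3 * \<theta> * P i Z + \<theta> * \<epsilon>)"
      using excess_value_bound[OF eq i _ \<theta> win[OF i]] int unfolding A_def[symmetric] P_def[symmetric]
      by (intro measure_pmf.integral_ge_const) (auto simp: AE_measure_pmf_iff)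
    then show ?thesis using int by simp
  qed
  have "SW_max \<le> real k * \<theta> + (\<Sum>i<N. measure_pmf.expectation (F i) (\<lambda>v. max 0 (v - \<theta>)))"
    using \<theta> by (intro SW_max_le) simp
  also have "(\<Sum>i<N. measure_pmf.expectation (F i) (\<lambda>v. max 0 (v - \<theta>)))
      \<le> (\<Sum>i<N. 3 * measure_pmf.expectation (M i) (A i) + 3 * \<theta> * measure_pmf.expectation (M i) (P i) + \<theta> * \<epsilon>)"
    using agent by (intro sum_mono) auto
  also have "\<dots> = 3 * (\<Sum>i<N. measure_pmf.expectation (M i) (A i))
      + 3 * \<theta> * (\<Sum>i<N. measure_pmf.expectation (M i) (P i)) + real N * (\<theta> * \<epsilon>)"
    by (simp add: sum.distrib sum_distrib_left)
  also have "(\<Sum>i<N. measure_pmf.expectation (M i) (A i)) \<le> SW M"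
    unfolding A_def[abs_def] by (rule sum_expected_win_value_le_SW)
  also have "SW M \<le> x" by (rule x)
  also have "(\<Sum>i<N. measure_pmf.expectation (M i) (P i)) = k"
    unfolding P_def[abs_def] by (rule sum_expected_win_prob)
  also have "real N * (\<theta> * \<epsilon>) \<le> real N * (3 * x * \<epsilon>)"
    using \<theta>_le eps_pos by (intro mult_left_mono mult_right_mono) auto
  finally show ?thesis using k\<theta> by (simp add: algebra_simps)
qed

text \<open>The bound for positive \<open>x\<close> is applied slightly above \<open>SW M\<close>;
  the offset \<open>d / C\<close> costs exactly \<open>d\<close>.\<close>

lemma SW_max_le_equilibrium:
  assumes "nash_equilibrium M"
  shows "SW_max \<le> (15 + 3 * (\<epsilon> * real N)) * SW M"
proof (rule field_le_epsilon)
  fix d :: real assume d: "0 < d"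
  define C where "C = 15 + 3 * (\<epsilon> * real N)"
  have C: "0 < C" using eps_pos by (simp add: C_def add_pos_nonneg)
  have "SW_max \<le> C * (SW M + d / C)"
    unfolding C_def[symmetric] using SW_max_le_equilibrium_bound[OF assms, of "SW M + d / C"] SW_nonneg[of M] C d
    by (simp add: C_def[symmetric] add_nonneg_pos)
  then show "SW_max \<le> (15 + 3 * (\<epsilon> * real N)) * SW M + d"
    using C by (simp add: C_def[symmetric] distrib_left)
qed

end

theorem theoremA1:
  fixes N k :: nat and \<epsilon> :: real and V :: "real set"
    and t :: "nat \<Rightarrow> real \<Rightarrow> nat" and F :: "nat \<Rightarrow> real pmf" and u :: "nat \<Rightarrow> real \<Rightarrow> real"
  assumes game: "persuasion_game N k \<epsilon> V t F u"
    and eps_small: "2.3766 * (\<epsilon> * real N) < 1"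
  shows "persuasion_game.price_of_anarchy N k V t F u
           \<le> ereal (22.459 / (1 - 2.3766 * (\<epsilon> * real N)))
       \<and> (\<forall>M. persuasion_game.nash_equilibrium N k V t F u M \<longrightarrow>
             persuasion_game.SW_max N k F
               \<le> 22.459 / (1 - 2.3766 * (\<epsilon> * real N)) * persuasion_game.SW N k F M)"
proof -
  interpret persuasion_game N k \<epsilon> V t F u by (rule game)
  define C where "C = 22.459 / (1 - 2.3766 * (\<epsilon> * real N))"
  have x0: "0 \<le> \<epsilon> * real N" using eps_pos by simp
  have "22.459 \<le> C" using x0 eps_small by (simp add: C_def pos_le_divide_eq)
  \<comment> \<open>Since \<open>\<epsilon> * real N < 1 / 2.3766\<close>, the left side is below
    16.3.\<close>
  moreover have "15 + 3 * (\<epsilon> * real N) \<le> 22.459" using eps_small by simp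
  ultimately have C: "15 + 3 * (\<epsilon> * real N) \<le> C" "0 < C" by auto
  have bound: "SW_max \<le> C * SW M" if "nash_equilibrium M" for M
    using SW_max_le_equilibrium[OF that] mult_right_mono[OF C(1) SW_nonneg[of M]] by linarith
  have "price_of_anarchy \<le> ereal C"
  \<comment> \<open>If \<open>SW_max\<close> is positive, \<open>bound\<close> keeps the infimum at
    or above \<open>SW_max / C > 0\<close>, so the quotient never divides by zero; an infinite
    infimum gives quotient 0. Otherwise the quotient is at most 0, including the case
    \<open>0 / 0 = 0\<close>.\<close>
  proof (cases "SW_max \<le> 0")
    case True
    have "0 \<le> (INF M\<in>{M. nash_equilibrium M}. ereal (SW M))"
      by (intro INF_greatest) (simp add: SW_nonneg)
    then have "price_of_anarchy \<le> 0"
      unfolding price_of_anarchy_def using True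
      by (cases "INF M\<in>{M. nash_equilibrium M}. ereal (SW M)")
         (auto simp: divide_le_0_iff zero_ereal_def)
    then show ?thesis using C by (meson ereal_less_eq(5) less_imp_le order_trans)
  next
    case False
    define I where "I = (INF M\<in>{M. nash_equilibrium M}. ereal (SW M))"
    have "ereal (SW_max / C) \<le> I"
      unfolding I_def using bound C by (intro INF_greatest) (auto simp: pos_divide_le_eq mult.commute)
    then have "ereal SW_max / I \<le> ereal C"
    proof (cases I)
      case (real y)
      then have "SW_max / C \<le> y" using \<open>ereal (SW_max / C) \<le> I\<close> by simp
      moreover have "0 < SW_max / C" using False C by simp
      ultimately have "0 < y" by linarith
      moreover have "SW_max \<le> C * y"
        using \<open>SW_max / C \<le> y\<close> C by (simp add: pos_divide_le_eq mult.commute)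
      ultimately show ?thesis using real by (simp add: pos_divide_le_eq)
    qed (use C in auto)
    then show ?thesis by (simp add: price_of_anarchy_def I_def)
  qed
  then show ?thesis using bound unfolding C_def by blast
qed

end
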